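(* (i) Let $\mathcal{B}\leq \mathrm{M}(n,\mathbb{C})$ be an irreducible matrix Lie algebra which is not the trivial irreducible matrix Lie algebra. Then $\mathcal{B}$ does not have a shrunk subspace. (ii) Let $\mathcal{B}\leq \mathrm{M}(n,\mathbb{C})$ be a matrix Lie algebra. Then $\mathcal{B}$ has a shrunk subspace if and only if one of its composition factors is the trivial irreducible matrix Lie algebra.
   Context: $\mathrm{M}(n,\mathbb{F})$ denotes the space of $n\times n$ matrices over $\mathbb{F}$. A matrix Lie algebra is a linear subspace $\mathcal{B}\leq\mathrm{M}(n,\mathbb{F})$ closed under the commutator $[A,B]=AB-BA$. For $U\leq \mathbb{F}^n$, $\mathcal{B}(U)=\langle Bu : B\in\mathcal{B}, u\in U\rangle$; $U$ is a shrunk subspace of $\mathcal{B}$ if $\dim U>\dim \mathcal{B}(U)$. A subspace $U$ is invariant if $B(U)\subseteq U$ for all $B\in\mathcal{B}$; $\mathcal{B}$ is irreducible if its only invariant subspaces are $0$ and $\mathbb{F}^n$. The trivial irreducible matrix Lie algebra is $\{0\}\leq \mathrm{M}(1,\mathbb{F})$. For a matrix Lie algebra $\mathcal{B}$ there is an invertible $A$ such that $A^{-1}\mathcal{B}A$ consists of block upper-triangular matrices (with a common block structure) whose diagonal blocks each span an irreducible matrix Lie algebra; these irreducible matrix Lie algebras (the spans of the $i$-th diagonal blocks) are the composition factors of $\mathcal{B}$, well defined up to isomorphism by the Jordan–Hölder theorem. *)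

theory Defs
  imports "Jordan_Normal_Form.VS_Connect" Complex_Main
begin

definition vec_subspace :: "nat \<Rightarrow> 'a :: field vec set \<Rightarrow> bool" where
  "vec_subspace n U \<longleftrightarrow> VectorSpace.subspace class_ring U (module_vec TYPE('a) n)"

definition subspace_dim :: "nat \<Rightarrow> 'a :: field vec set \<Rightarrow> nat" where
  "subspace_dim n U = vectorspace.dim class_ring ((module_vec TYPE('a) n)\<lparr>carrier := U\<rparr>)"

definition matrix_lie_algebra :: "nat \<Rightarrow> 'a :: field mat set \<Rightarrow> bool" where
  "matrix_lie_algebra n \<B> \<longleftrightarrow>
     VectorSpace.subspace class_ring \<B> (module_mat TYPE('a) n n) \<and>
     (\<forall>A\<in>\<B>. \<forall>B\<in>\<B>. A * B - B * A \<in> \<B>)"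

text \<open>The space \<open>\<B>(U)\<close>, the linear span of all products \<open>B u\<close>.\<close>

definition action_span :: "nat \<Rightarrow> 'a :: field mat set \<Rightarrow> 'a vec set \<Rightarrow> 'a vec set" where
  "action_span n \<B> U =
     LinearCombinations.module.span class_ring (module_vec TYPE('a) n)
       {B *\<^sub>v u | B u. B \<in> \<B> \<and> u \<in> U}"

definition shrunk_subspace :: "nat \<Rightarrow> 'a :: field mat set \<Rightarrow> 'a vec set \<Rightarrow> bool" where
  "shrunk_subspace n \<B> U \<longleftrightarrow>
     vec_subspace n U \<and> subspace_dim n U > subspace_dim n (action_span n \<B> U)"

definition has_shrunk_subspace :: "nat \<Rightarrow> 'a :: field mat set \<Rightarrow> bool" where
  "has_shrunk_subspace n \<B> \<longleftrightarrow> (\<exists>U. shrunk_subspace n \<B> U)"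

definition invariant_subspace :: "nat \<Rightarrow> 'a :: field mat set \<Rightarrow> 'a vec set \<Rightarrow> bool" where
  "invariant_subspace n \<B> U \<longleftrightarrow>
     vec_subspace n U \<and> (\<forall>B\<in>\<B>. (\<lambda>u. B *\<^sub>v u) ` U \<subseteq> U)"

definition irreducible_matrix_lie_algebra :: "nat \<Rightarrow> 'a :: field mat set \<Rightarrow> bool" where
  "irreducible_matrix_lie_algebra n \<B> \<longleftrightarrow>
     matrix_lie_algebra n \<B> \<and>
     (\<forall>U. invariant_subspace n \<B> U \<longrightarrow> U = {0\<^sub>v n} \<or> U = carrier_vec n)"

definition trivial_irreducible :: "nat \<Rightarrow> 'a :: field mat set \<Rightarrow> bool" where
  "trivial_irreducible n \<B> \<longleftrightarrow> n = 1 \<and> \<B> = {0\<^sub>m 1 1}"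

text \<open>A block structure on \<open>n\<close> indices is the list \<open>ds\<close> of its (positive) block sizes; block
  number \<open>i\<close> consists of the indices from \<open>block_start ds i\<close> up to, but excluding,
  \<open>block_start ds (Suc i)\<close>.\<close>

definition block_start :: "nat list \<Rightarrow> nat \<Rightarrow> nat" where
  "block_start ds i = sum_list (take i ds)"

definition block_upper_triangular :: "nat list \<Rightarrow> 'a :: zero mat \<Rightarrow> bool" where
  "block_upper_triangular ds M \<longleftrightarrow>
     (\<forall>i<length ds. \<forall>r\<in>{block_start ds i ..< block_start ds (Suc i)}.
        \<forall>c<block_start ds i. M $$ (r, c) = 0)"

definition diagonal_block :: "nat list \<Rightarrow> nat \<Rightarrow> 'a mat \<Rightarrow> 'a mat" where
  "diagonal_block ds i M =
     mat (ds ! i) (ds ! i) (\<lambda>(r, c). M $$ (block_start ds i + r, block_start ds i + c))"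

definition diagonal_block_span ::
  "nat list \<Rightarrow> nat \<Rightarrow> 'a :: field mat set \<Rightarrow> 'a mat set" where
  "diagonal_block_span ds i \<M> =
     LinearCombinations.module.span class_ring (module_mat TYPE('a) (ds ! i) (ds ! i))
       (diagonal_block ds i ` \<M>)"

text \<open>\<open>A'\<close> is the inverse of the base change \<open>A\<close>.\<close>

definition composition_form ::
  "nat \<Rightarrow> 'a :: field mat set \<Rightarrow> 'a mat \<Rightarrow> 'a mat \<Rightarrow> nat list \<Rightarrow> bool" where
  "composition_form n \<B> A A' ds \<longleftrightarrow>
     A \<in> carrier_mat n n \<and> A' \<in> carrier_mat n n \<and> inverts_mat A A' \<and> inverts_mat A' A \<and>
     (\<forall>d\<in>set ds. d > 0) \<and> sum_list ds = n \<and>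
     (\<forall>B\<in>\<B>. block_upper_triangular ds (A' * B * A)) \<and>
     (\<forall>i<length ds. irreducible_matrix_lie_algebra (ds ! i)
        (diagonal_block_span ds i ((\<lambda>B. A' * B * A) ` \<B>)))"

text \<open>\<open>\<C> \<le> M(d, F)\<close> is a composition factor of \<open>\<B> \<le> M(n, F)\<close>. Composition factors are only
  determined up to isomorphism (simultaneous conjugation); letting the base change \<open>A\<close> range
  over all choices yields the full isomorphism classes.\<close>

definition composition_factor ::
  "nat \<Rightarrow> 'a :: field mat set \<Rightarrow> nat \<Rightarrow> 'a mat set \<Rightarrow> bool" where
  "composition_factor n \<B> d \<C> \<longleftrightarrow>
     (\<exists>A A' ds i. composition_form n \<B> A A' ds \<and> i < length ds \<and> d = ds ! i \<and>
        \<C> = diagonal_block_span ds i ((\<lambda>B. A' * B * A) ` \<B>))"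

end

theory Submission
  imports Defs "Jordan_Normal_Form.DL_Rank"
begin

text \<open>
  Among the subspaces \<open>U\<close> maximising \<open>dim U - dim \<B>(U)\<close> choose one of least dimension and let
  \<open>W = \<B>(U)\<close>. For \<open>b \<in> \<B>\<close> the commutator relation \<open>b c - c b \<in> \<B>\<close> shows that \<open>\<B>\<close> maps
  \<open>{u \<in> U. b u \<in> U}\<close> into \<open>{w \<in> W. b w \<in> W}\<close> and \<open>U + b U\<close> into \<open>W + b W\<close>. Since
  \<open>dim {u \<in> U. b u \<in> U} + dim (U + b U) = 2 dim U\<close>, and likewise for \<open>W\<close>, both new subspaces are
  again maximisers, so \<open>{u \<in> U. b u \<in> U} = U\<close> by the choice of \<open>U\<close>. Thus an algebra with a shrunk
  subspace has an invariant one. In the irreducible case this is the whole space, whose image is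
  invariant and proper, hence zero. In general, \<open>\<B>(U) < U\<close> are invariant subspaces with \<open>\<B>\<close>
  acting as zero on the quotient, and refining this flag to a composition series produces a trivial
  factor. Conversely, a trivial factor of a flag \<open>V\<^sub>0 < V\<^sub>1 < \<dots>\<close> in position \<open>i\<close> means
  \<open>\<B>(V\<^sub>i\<^sub>+\<^sub>1) \<le> V\<^sub>i\<close> with \<open>dim V\<^sub>i\<^sub>+\<^sub>1 = dim V\<^sub>i + 1\<close>. All of this works over an arbitrary field.
\<close>

section \<open>Subspaces and their dimension\<close>

lemma vec_subspace_iff:
  fixes U :: "'a :: field vec set"
  shows "vec_subspace n U \<longleftrightarrow> U \<subseteq> carrier_vec n \<and> 0\<^sub>v n \<in> U \<and>
    (\<forall>u\<in>U. \<forall>v\<in>U. u + v \<in> U) \<and> (\<forall>c. \<forall>u\<in>U. c \<cdot>\<^sub>v u \<in> U)"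
  unfolding vec_subspace_def subspace_def submodule_def
  using vec_vs[where 'a = 'a and n = n] vec_module[where 'a = 'a and n = n]
  by (auto simp: module_vec_simps class_ring_simps)

lemma mat_subspace_iff:
  fixes \<B> :: "'a :: field mat set"
  shows "VectorSpace.subspace class_ring \<B> (module_mat TYPE('a) n m) \<longleftrightarrow>
    \<B> \<subseteq> carrier_mat n m \<and> 0\<^sub>m n m \<in> \<B> \<and>
    (\<forall>A\<in>\<B>. \<forall>B\<in>\<B>. A + B \<in> \<B>) \<and> (\<forall>c. \<forall>A\<in>\<B>. c \<cdot>\<^sub>m A \<in> \<B>)"
proof -
  interpret vectorspace class_ring "module_mat TYPE('a) n m" by (rule matrix_vs)
  show ?thesis
    unfolding subspace_def submodule_def
    using matrix_vs[where 'a = 'a and nr = n and nc = m] module_axioms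
    by (auto simp: module_mat_simps class_ring_simps)
qed

lemma vec_subspaceI:
  assumes "U \<subseteq> carrier_vec n" "0\<^sub>v n \<in> U" "\<And>u v. u \<in> U \<Longrightarrow> v \<in> U \<Longrightarrow> u + v \<in> U"
    and "\<And>c u. u \<in> U \<Longrightarrow> c \<cdot>\<^sub>v u \<in> U"
  shows "vec_subspace n U"
  using assms unfolding vec_subspace_iff by blast

lemma vec_subspaceD:
  assumes "vec_subspace n U"
  shows "U \<subseteq> carrier_vec n" "0\<^sub>v n \<in> U" "\<And>u v. u \<in> U \<Longrightarrow> v \<in> U \<Longrightarrow> u + v \<in> U"
    "\<And>c u. u \<in> U \<Longrightarrow> c \<cdot>\<^sub>v u \<in> U"
  using assms unfolding vec_subspace_iff by auto

text \<open>Independent subsets of \<open>U\<close> have at most \<open>n\<close> elements, so a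
  maximal one exists. Adjoining any further vector of \<open>U\<close> makes it dependent, hence
  that vector already lies in its span.\<close>

lemma vec_subspace_finite_basis:
  fixes U :: "'a :: field vec set"
  assumes U: "vec_subspace n U"
  obtains A where "finite A" "A \<subseteq> carrier_vec n"
    "\<not> LinearCombinations.module.lin_dep class_ring (module_vec TYPE('a) n) A"
    "LinearCombinations.module.span class_ring (module_vec TYPE('a) n) A = U"
proof -
  interpret vec_space "TYPE('a)" n .
  have Uc: "U \<subseteq> carrier_vec n" using vec_subspaceD(1)[OF U] .
  have sub: "submodule class_ring U V" using U by (auto simp: vec_subspace_def subspace_def)
  obtain A where A: "finite A" "maximal A (\<lambda>S. S \<subseteq> U \<and> lin_indpt S)"
  proof -
    have "finite S \<and> card S \<le> dim" if "S \<subseteq> U \<and> lin_indpt S" for S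
      using li_le_dim[OF fin_dim, of S] that Uc by auto
    moreover have "{} \<subseteq> U \<and> lin_indpt {}"
      using finite_lin_indpt2[of "{}"] by auto
    ultimately show ?thesis
      using maximal_exists[of "\<lambda>S. S \<subseteq> U \<and> lin_indpt S" dim "{}"] that by blast
  qed
  have AU: "A \<subseteq> U" and li: "lin_indpt A" using A(2) by (auto simp: maximal_def)
  have "U \<subseteq> span A"
  proof
    fix u assume u: "u \<in> U"
    show "u \<in> span A"
    proof (cases "u \<in> A")
      case True
      then show ?thesis using in_own_span AU Uc by blast
    next
      case False
      have "lin_dep (A \<union> {u})"
      proof (rule ccontr)
        assume "\<not> lin_dep (A \<union> {u})"
        then have "A \<union> {u} = A" using A(2) AU u by (auto simp: maximal_def)
        then show False using False by auto
      qed
      then show ?thesis using lin_dep_iff_in_span[OF _ li, of u] False u AU Uc by auto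
    qed
  qed
  moreover have "span A \<subseteq> U" by (rule span_is_subset[OF AU sub])
  ultimately show thesis using that[OF A(1) _ li] AU Uc by auto
qed

text \<open>For invertible \<open>Q\<close> this is the span of the first \<open>k\<close> columns of the inverse of \<open>Q\<close>.\<close>

definition coord_subspace :: "nat \<Rightarrow> nat \<Rightarrow> 'a :: field mat \<Rightarrow> 'a vec set" where
  "coord_subspace n k Q = {u \<in> carrier_vec n. \<forall>i. k \<le> i \<and> i < n \<longrightarrow> (Q *\<^sub>v u) $ i = 0}"

text \<open>Multiplication by \<open>A\<close> is a linear map on the space with carrier
  \<open>U\<close>, which is finite-dimensional by the basis above. The dimension counts that follow
  all rest on this restricted form of rank-nullity.\<close>

lemma rank_nullity_mat:
  fixes A :: "'a :: field mat"
  assumes A: "A \<in> carrier_mat m n" and U: "vec_subspace n U"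
  shows "vec_subspace m ((*\<^sub>v) A ` U)"
    and "subspace_dim m ((*\<^sub>v) A ` U) + subspace_dim n {u \<in> U. A *\<^sub>v u = 0\<^sub>v m} = subspace_dim n U"
proof -
  interpret n: vec_space "TYPE('a)" n .
  interpret m: vec_space "TYPE('a)" m .
  have Uc: "U \<subseteq> carrier_vec n" using vec_subspaceD(1)[OF U] .
  interpret VU: vectorspace class_ring "n.V\<lparr>carrier := U\<rparr>"
    using U n.subspace_is_vs unfolding vec_subspace_def by blast
  interpret L: linear_map class_ring "n.V\<lparr>carrier := U\<rparr>" m.V "(*\<^sub>v) A"
    by (unfold_locales; use Uc A in \<open>auto simp: LinearCombinations.module_hom_def module_vec_simps
        class_ring_simps mult_add_distrib_mat_vec[OF A] mult_mat_vec[OF A] subset_iff\<close>)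
  show "vec_subspace m ((*\<^sub>v) A ` U)"
    using L.imT_is_subspace unfolding vec_subspace_def L.im_def by simp
  obtain S where "finite S" "S \<subseteq> carrier_vec n" "n.span S = U"
    using vec_subspace_finite_basis[OF U] by blast
  then have fd: "VU.fin_dim" using n.fin_dim_span[of S] by simp
  show "subspace_dim m ((*\<^sub>v) A ` U) + subspace_dim n {u \<in> U. A *\<^sub>v u = 0\<^sub>v m} = subspace_dim n U"
    using L.rank_nullity[OF fd] unfolding subspace_dim_def L.im_def L.ker_def
    by (simp add: module_vec_simps)
qed

lemma subspace_dim_carrier: "subspace_dim n (carrier_vec n :: 'a :: field vec set) = n"
proof -
  interpret vec_space "TYPE('a)" n .
  show ?thesis using dim_is_n by (simp add: subspace_dim_def module_vec_def)
qed

lemma subspace_dim_zero: "subspace_dim n {0\<^sub>v n :: 'a :: field vec} = 0"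
proof -
  interpret vec_space "TYPE('a)" n .
  show ?thesis using dim_zero_vs span_empty by (simp add: subspace_dim_def)
qed

lemma vec_subspace_carrier: "vec_subspace n (carrier_vec n)"
  by (rule vec_subspaceI) auto

lemma coord_subspace_is_subspace:
  assumes Q: "Q \<in> carrier_mat n n"
  shows "vec_subspace n (coord_subspace n k Q)"
proof -
  have "(Q *\<^sub>v u) $ i = 0 \<longleftrightarrow> row Q i \<bullet> u = 0" if "i < n" for i u
    using that Q by simp
  then show ?thesis
    using Q by (intro vec_subspaceI)
      (auto simp: coord_subspace_def scalar_prod_add_distrib[of _ n] cong: conj_cong)
qed

lemma coord_subspace_dim:
  fixes P :: "'a :: field mat"
  assumes P: "P \<in> carrier_mat n n" and Q: "Q \<in> carrier_mat n n"
    and PQ: "P * Q = 1\<^sub>m n" and QP: "Q * P = 1\<^sub>m n" and k: "k \<le> n"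
  shows "subspace_dim n (coord_subspace n k Q) = k"
proof -
  let ?U = "coord_subspace n k Q"
  \<comment> \<open>\<open>T\<close> consists of the first \<open>k\<close> rows of \<open>Q\<close> and maps the subspace isomorphically onto the \<open>k\<close>-space\<close>
  define T where "T = mat k n (($$) Q)"
  have T: "T \<in> carrier_mat k n" by (simp add: T_def)
  have Tu: "T *\<^sub>v u = vec k (($) (Q *\<^sub>v u))" if "u \<in> carrier_vec n" for u
    using that Q k by (intro eq_vecI) (auto simp: T_def scalar_prod_def)
  have "(*\<^sub>v) T ` ?U = carrier_vec k"
  proof (intro equalityI subsetI)
    fix v :: "'a vec" assume v: "v \<in> carrier_vec k"
    \<comment> \<open>The preimage of \<open>v\<close> is the vector whose
      \<open>Q\<close>-coordinates are those of \<open>v\<close> padded with zeros.\<close>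
    define w where "w = vec n (\<lambda>i. if i < k then v $ i else 0)"
    have w: "w \<in> carrier_vec n" by (simp add: w_def)
    have QPw: "Q *\<^sub>v (P *\<^sub>v w) = w"
      using assoc_mult_mat_vec[OF Q P w] QP w by simp
    have "P *\<^sub>v w \<in> ?U" using P w QPw by (auto simp: coord_subspace_def w_def)
    moreover have "T *\<^sub>v (P *\<^sub>v w) = v"
      using P w QPw v k by (subst Tu) (auto simp: w_def)
    ultimately show "v \<in> (*\<^sub>v) T ` ?U" by force
  qed (use T in \<open>auto simp: coord_subspace_def\<close>)
  \<comment> \<open>The equation \<open>T *\<^sub>v u = 0\<^sub>v k\<close> kills the first
    \<open>k\<close> coordinates of \<open>Q *\<^sub>v u\<close> and membership in \<open>?U\<close>
    kills the others, so \<open>Q *\<^sub>v u\<close> is zero, and with it \<open>u\<close>.\<close>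
  moreover have "{u \<in> ?U. T *\<^sub>v u = 0\<^sub>v k} = {0\<^sub>v n}"
  proof (intro equalityI subsetI)
    fix u assume "u \<in> {u \<in> ?U. T *\<^sub>v u = 0\<^sub>v k}"
    then have u: "u \<in> carrier_vec n" and hi: "\<And>i. k \<le> i \<Longrightarrow> i < n \<Longrightarrow> (Q *\<^sub>v u) $ i = 0"
      and "T *\<^sub>v u = 0\<^sub>v k" by (auto simp: coord_subspace_def)
    then have lo: "(Q *\<^sub>v u) $ i = 0" if "i < k" for i
      using that Tu[OF u] by (metis index_vec index_zero_vec(1))
    have "(Q *\<^sub>v u) $ i = 0" if "i < n" for i
      using that hi lo by (cases "i < k") auto
    then have "Q *\<^sub>v u = 0\<^sub>v n" using Q by (intro eq_vecI) auto
    then have "P *\<^sub>v (Q *\<^sub>v u) = 0\<^sub>v n" using P by auto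
    then show "u \<in> {0\<^sub>v n}" using assoc_mult_mat_vec[OF P Q u] PQ u by simp
  qed (use T vec_subspaceD(2)[OF coord_subspace_is_subspace[OF Q]] in auto)
  ultimately show ?thesis
    using rank_nullity_mat(2)[OF T coord_subspace_is_subspace[OF Q], of k]
    by (simp add: subspace_dim_carrier subspace_dim_zero)
qed

text \<open>A basis of \<open>U\<close> is extended to a basis of the whole space, whose vectors
  become the columns of \<open>P\<close>. In these coordinates \<open>U\<close> is cut out by the
  vanishing of the last coordinates, which is how subspaces are turned into block structure.\<close>

lemma adapted_base_change:
  fixes U :: "'a :: field vec set"
  assumes U: "vec_subspace n U"
  obtains P Q k where "P \<in> carrier_mat n n" "Q \<in> carrier_mat n n" "P * Q = 1\<^sub>m n" "Q * P = 1\<^sub>m n"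
    "k \<le> n" "U = coord_subspace n k Q"
proof -
  interpret vec_space "TYPE('a)" n .
  obtain A where A: "finite A" "A \<subseteq> carrier_vec n" "lin_indpt A" "span A = U"
    using vec_subspace_finite_basis[OF U] by blast
  obtain B where B: "maximal B (\<lambda>S. S \<subseteq> carrier_vec n \<and> lin_indpt S)" "A \<subseteq> B"
  proof -
    let ?P = "\<lambda>S. A \<subseteq> S \<and> S \<subseteq> carrier_vec n \<and> lin_indpt S"
    have "finite S \<and> card S \<le> dim" if "?P S" for S
      using li_le_dim[OF fin_dim, of S] that by auto
    then obtain B where "maximal B ?P"
      using maximal_exists[of ?P dim A] A by blast
    \<comment> \<open>Any independent superset of \<open>B\<close> still contains \<open>A\<close>,
      so \<open>B\<close> is maximal among all independent sets.\<close>
    then show ?thesis using that[of B] unfolding maximal_def by (meson order_trans)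
  qed
  have basis: "basis B" using max_li_is_basis B(1) by simp
  then have Bc: "B \<subseteq> carrier_vec n" and liB: "lin_indpt B" by (auto simp: basis_def)
  have finB: "finite B" using li_le_dim(1)[OF fin_dim _ liB] Bc by simp
  have cardB: "card B = n" using dim_basis[OF finB basis] dim_is_n by simp
  obtain as where as: "set as = A" "distinct as" using finite_distinct_list[OF A(1)] by auto
  obtain bs where bs: "set bs = B - A" "distinct bs"
    using finite_distinct_list[OF finite_Diff[OF finB]] by metis
  let ?k = "length as"
  \<comment> \<open>The basis of \<open>U\<close> is listed first, so that \<open>U\<close> is
    spanned by an initial segment of the columns.\<close>
  define P where "P = mat_of_cols n (as @ bs)"
  have set: "set (as @ bs) = B" and dist: "distinct (as @ bs)" using as bs B(2) by auto
  then have len: "length (as @ bs) = n" using cardB distinct_card by metis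
  have P: "P \<in> carrier_mat n n" unfolding P_def using len by auto
  have cols: "cols P = as @ bs" unfolding P_def by (rule cols_mat_of_cols) (use Bc set in auto)
  \<comment> \<open>Distinct independent columns give full rank, hence a nonzero determinant, hence
    an inverse.\<close>
  have "rank P = n" using lin_indpt_full_rank[OF P] cols dist set liB by simp
  then have "det P \<noteq> 0" using det_rank_iff[OF P] by simp
  from det_non_zero_imp_unit[OF P this]
  obtain Q where Q: "Q \<in> carrier_mat n n" "Q * P = 1\<^sub>m n" "P * Q = 1\<^sub>m n"
    by (auto simp: Units_def ring_mat_simps)
  have k: "?k \<le> n" using len by simp
  have colA: "col P i = as ! i" if "i < ?k" for i
    using that k cols P by (metis carrier_matD(2) cols_nth nth_append order_less_le_trans)
  \<comment> \<open>Only the first \<open>?k\<close> columns contribute, since the remaining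
    coordinates of \<open>v\<close> vanish.\<close>
  have Pv: "P *\<^sub>v v = lincomb_list (($) v) as" if v: "v \<in> carrier_vec n" "\<forall>i. ?k \<le> i \<and> i < n \<longrightarrow> v $ i = 0" for v
  proof -
    have "lincomb_list (($) v) as = mat_of_cols n as *\<^sub>v vec ?k (($) v)"
      using A(2) as by (intro lincomb_list_as_mat_mult) auto
    also have "\<dots> = P *\<^sub>v v"
    proof (rule eq_vecI)
      fix i assume "i < dim_vec (P *\<^sub>v v)"
      then have i: "i < n" using P by simp
      have "(P *\<^sub>v v) $ i = (\<Sum>j<n. P $$ (i, j) * v $ j)"
        using i P v by (simp add: scalar_prod_def atLeast0LessThan)
      also have "\<dots> = (\<Sum>j<?k. P $$ (i, j) * v $ j)"
        using v k by (intro sum.mono_neutral_right) auto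
      also have "\<dots> = (mat_of_cols n as *\<^sub>v vec ?k (($) v)) $ i"
        using i P k by (auto simp: scalar_prod_def atLeast0LessThan mat_of_cols_def P_def nth_append intro!: sum.cong)
      finally show "(mat_of_cols n as *\<^sub>v vec ?k (($) v)) $ i = (P *\<^sub>v v) $ i" by simp
    qed (use P in auto)
    finally show ?thesis by simp
  qed
  have "U = coord_subspace n ?k Q"
  proof (intro equalityI subsetI)
    fix u assume u: "u \<in> U"
    then have "u \<in> span_list as" using span_list_as_span[of as] A as by simp
    then obtain c where c: "u = lincomb_list c as" by (auto elim: in_span_listE)
    define v where "v = vec n (\<lambda>i. if i < ?k then c i else 0)"
    have v: "v \<in> carrier_vec n" by (simp add: v_def)
    have "lincomb_list (($) v) as = lincomb_list c as"
      unfolding lincomb_list_def using k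
      by (intro arg_cong[where f = sumlist] map_cong) (auto simp: v_def)
    then have "u = P *\<^sub>v v" using Pv[OF v] c by (simp add: v_def)
    then have "Q *\<^sub>v u = v" "u \<in> carrier_vec n" using assoc_mult_mat_vec[OF Q(1) P v] Q v P by auto
    then show "u \<in> coord_subspace n ?k Q" by (auto simp: coord_subspace_def v_def)
  next
    fix u assume "u \<in> coord_subspace n ?k Q"
    then have u: "u \<in> carrier_vec n" "\<forall>i. ?k \<le> i \<and> i < n \<longrightarrow> (Q *\<^sub>v u) $ i = 0"
      by (auto simp: coord_subspace_def)
    have "u = P *\<^sub>v (Q *\<^sub>v u)" using assoc_mult_mat_vec[OF P Q(1) u(1)] Q u by simp
    also have "\<dots> = lincomb_list (($) (Q *\<^sub>v u)) as" using u Q by (intro Pv) auto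
    also have "\<dots> \<in> span_list as" unfolding span_list_def by auto
    finally show "u \<in> U" using span_list_as_span[of as] A as by simp
  qed
  then show thesis by (rule that[OF P Q(1) Q(3,2) k])
qed

text \<open>The last \<open>n - k\<close> rows of an adapted \<open>Q\<close> serve as
  \<open>T\<close>. Such a \<open>T\<close> stands in for the quotient map modulo \<open>U\<close>:
  it turns membership in \<open>U\<close> into an equation to which rank-nullity applies.\<close>

lemma subspace_as_kernel:
  fixes U :: "'a :: field vec set"
  assumes U: "vec_subspace n U"
  obtains T m where "T \<in> carrier_mat m n" "U = {u \<in> carrier_vec n. T *\<^sub>v u = 0\<^sub>v m}"
proof -
  obtain P Q k where "P \<in> carrier_mat n n" and PQ: "Q \<in> carrier_mat n n"
    and "P * Q = 1\<^sub>m n" "Q * P = 1\<^sub>m n" and PQ': "k \<le> n" "U = coord_subspace n k Q"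
    by (rule adapted_base_change[OF U])
  note PQ = PQ PQ'
  define T where "T = mat (n - k) n (\<lambda>(i, j). Q $$ (k + i, j))"
  have T: "T \<in> carrier_mat (n - k) n" by (simp add: T_def)
  have Tu: "T *\<^sub>v u = vec (n - k) (\<lambda>i. (Q *\<^sub>v u) $ (k + i))" if "u \<in> carrier_vec n" for u
    using that PQ(1,2) by (intro eq_vecI) (auto simp: T_def scalar_prod_def)
  have ker: "u \<in> U \<longleftrightarrow> u \<in> carrier_vec n \<and> T *\<^sub>v u = 0\<^sub>v (n - k)" for u
  proof (cases "u \<in> carrier_vec n")
    case True
    have "(\<forall>i. k \<le> i \<and> i < n \<longrightarrow> (Q *\<^sub>v u) $ i = 0) \<longleftrightarrow> (\<forall>i<n - k. (Q *\<^sub>v u) $ (k + i) = 0)"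
    proof (intro iffI allI impI)
      fix i assume all: "\<forall>i<n - k. (Q *\<^sub>v u) $ (k + i) = 0" and "k \<le> i \<and> i < n"
      then have "i - k < n - k" "k + (i - k) = i" by auto
      then show "(Q *\<^sub>v u) $ i = 0" using all by metis
    qed auto
    then show ?thesis
      using True by (auto simp: PQ(3) coord_subspace_def Tu vec_eq_iff)
  qed (simp add: PQ(3) coord_subspace_def)
  show thesis by (rule that[OF T]) (use ker in blast)
qed

text \<open>Let \<open>T\<close> have kernel \<open>U\<close>. On \<open>U\<close> the matrix
  \<open>T * b\<close> has kernel \<open>{u \<in> U. b *\<^sub>v u \<in> U}\<close>, and on
  \<open>S\<close> the matrix \<open>T\<close> has kernel \<open>U\<close>. Both images agree
  because \<open>T\<close> kills the first summand of \<open>u + b *\<^sub>v v\<close>. If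
  \<open>r\<close> is their common dimension, the two dimensions on the left are
  \<open>dim U - r\<close> and \<open>dim U + r\<close>.\<close>

lemma dim_preimage_plus_dim_sum:
  fixes b :: "'a :: field mat"
  assumes b: "b \<in> carrier_mat n n" and U: "vec_subspace n U"
  defines "S \<equiv> {u + b *\<^sub>v v | u v. u \<in> U \<and> v \<in> U}"
  shows "vec_subspace n {u \<in> U. b *\<^sub>v u \<in> U}" "vec_subspace n S"
    "subspace_dim n {u \<in> U. b *\<^sub>v u \<in> U} + subspace_dim n S = 2 * subspace_dim n U"
proof -
  note UD = vec_subspaceD[OF U]
  have b_add: "b *\<^sub>v (u + v) = b *\<^sub>v u + b *\<^sub>v v" if "u \<in> U" "v \<in> U" for u v
    using that UD(1) by (intro mult_add_distrib_mat_vec[OF b]) auto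
  have b_smult: "b *\<^sub>v (c \<cdot>\<^sub>v u) = c \<cdot>\<^sub>v (b *\<^sub>v u)" if "u \<in> U" for c u
    using that UD(1) by (intro mult_mat_vec[OF b]) auto
  have b0: "b *\<^sub>v 0\<^sub>v n = 0\<^sub>v n" using b by auto
  show "vec_subspace n {u \<in> U. b *\<^sub>v u \<in> U}"
    by (rule vec_subspaceI) (use UD b0 in \<open>auto simp: b_add b_smult\<close>)
  show S: "vec_subspace n S"
  proof (rule vec_subspaceI)
    show "S \<subseteq> carrier_vec n" using UD(1) b by (auto simp: S_def intro!: add_carrier_vec mult_mat_vec_carrier)
    show "0\<^sub>v n \<in> S" unfolding S_def using UD(2) b0
      by (intro CollectI exI[of _ "0\<^sub>v n"]) auto
  next
    fix x y assume "x \<in> S" "y \<in> S"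
    then obtain u v u' v' where *: "x = u + b *\<^sub>v v" "y = u' + b *\<^sub>v v'" "u \<in> U" "v \<in> U" "u' \<in> U" "v' \<in> U"
      by (auto simp: S_def)
    have "x + y = (u + u') + b *\<^sub>v (v + v')"
      using * UD(1) b by (subst b_add) (auto intro!: eq_vecI simp: subset_iff)
    then show "x + y \<in> S" unfolding S_def using * UD(3) by blast
  next
    fix c x assume "x \<in> S"
    then obtain u v where *: "x = u + b *\<^sub>v v" "u \<in> U" "v \<in> U" by (auto simp: S_def)
    have "c \<cdot>\<^sub>v x = c \<cdot>\<^sub>v u + b *\<^sub>v (c \<cdot>\<^sub>v v)"
      using * UD(1) b by (subst b_smult) (auto intro!: smult_add_distrib_vec)
    then show "c \<cdot>\<^sub>v x \<in> S" unfolding S_def using * UD(4) by blast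
  qed
  obtain T m where T: "T \<in> carrier_mat m n"
    and "U = {u \<in> carrier_vec n. T *\<^sub>v u = 0\<^sub>v m}"
    by (rule subspace_as_kernel[OF U])
  then have ker: "u \<in> U \<longleftrightarrow> u \<in> carrier_vec n \<and> T *\<^sub>v u = 0\<^sub>v m" for u by blast
  have Tb: "T * b \<in> carrier_mat m n" using T b by auto
  have Tbu: "T * b *\<^sub>v u = T *\<^sub>v (b *\<^sub>v u)" if "u \<in> U" for u
    using that UD(1) T b by (intro assoc_mult_mat_vec) auto
  have "{u \<in> U. T * b *\<^sub>v u = 0\<^sub>v m} = {u \<in> U. b *\<^sub>v u \<in> U}"
    using b UD(1) by (auto simp: Tbu ker)
  moreover have "U \<subseteq> S"
  proof
    fix u assume "u \<in> U"
    then have "u = u + b *\<^sub>v 0\<^sub>v n" using UD(1) b0 by auto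
    then show "u \<in> S" unfolding S_def using \<open>u \<in> U\<close> UD(2) by blast
  qed
  then have "{u \<in> S. T *\<^sub>v u = 0\<^sub>v m} = U"
    using vec_subspaceD(1)[OF S] by (auto simp: ker)
  moreover have eq: "T *\<^sub>v (u + b *\<^sub>v v) = T * b *\<^sub>v v" if "u \<in> U" "v \<in> U" for u v
    using that ker[of u] b UD(1) T by (auto simp: Tbu mult_add_distrib_mat_vec[OF T])
  have "(*\<^sub>v) T ` S = (*\<^sub>v) (T * b) ` U"
  proof (intro equalityI subsetI)
    fix y assume "y \<in> (*\<^sub>v) T ` S"
    then obtain u v where "u \<in> U" "v \<in> U" "y = T *\<^sub>v (u + b *\<^sub>v v)" by (auto simp: S_def)
    then show "y \<in> (*\<^sub>v) (T * b) ` U" using eq by blast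
  next
    fix y assume "y \<in> (*\<^sub>v) (T * b) ` U"
    then obtain v where v: "v \<in> U" "y = T * b *\<^sub>v v" by blast
    have "0\<^sub>v n + b *\<^sub>v v \<in> S" using v(1) UD(2) by (auto simp: S_def)
    then show "y \<in> (*\<^sub>v) T ` S" using eq[OF UD(2) v(1)] v(2) by (metis image_eqI)
  qed
  ultimately show "subspace_dim n {u \<in> U. b *\<^sub>v u \<in> U} + subspace_dim n S = 2 * subspace_dim n U"
    using rank_nullity_mat(2)[OF T S] rank_nullity_mat(2)[OF Tb U] by simp
qed

lemma subspace_dim_eq_0:
  fixes U :: "'a :: field vec set"
  assumes U: "vec_subspace n U" and "subspace_dim n U = 0"
  shows "U = {0\<^sub>v n}"
proof -
  obtain P Q k where PQ: "P \<in> carrier_mat n n" "Q \<in> carrier_mat n n" "P * Q = 1\<^sub>m n" "Q * P = 1\<^sub>m n"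
    "k \<le> n" "U = coord_subspace n k Q"
    using adapted_base_change[OF U] .
  then have "k = 0" using coord_subspace_dim[OF PQ(1-5)] assms(2) by simp
  have "u = 0\<^sub>v n" if "u \<in> U" for u
  proof -
    have u: "u \<in> carrier_vec n" using that PQ(6) by (simp add: coord_subspace_def)
    have "Q *\<^sub>v u = 0\<^sub>v n"
      using that PQ(2,6) \<open>k = 0\<close> by (intro eq_vecI) (auto simp: coord_subspace_def)
    then have "P *\<^sub>v (Q *\<^sub>v u) = 0\<^sub>v n" using PQ(1) by auto
    then show ?thesis using assoc_mult_mat_vec[OF PQ(1,2) u] PQ(3) u by simp
  qed
  then show ?thesis using vec_subspaceD(2)[OF U] by blast
qed

text \<open>If \<open>T\<close> has kernel \<open>U\<close>, the dimension of \<open>T(W)\<close> is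
  the difference of the two dimensions; when they are equal, \<open>T\<close> vanishes on
  \<open>W\<close>.\<close>

lemma subspace_dim_mono:
  fixes U W :: "'a :: field vec set"
  assumes U: "vec_subspace n U" and W: "vec_subspace n W" and UW: "U \<subseteq> W"
  shows "subspace_dim n U \<le> subspace_dim n W"
    and "subspace_dim n U = subspace_dim n W \<Longrightarrow> U = W"
proof -
  obtain T m where T: "T \<in> carrier_mat m n"
    and "U = {u \<in> carrier_vec n. T *\<^sub>v u = 0\<^sub>v m}"
    by (rule subspace_as_kernel[OF U])
  then have ker: "u \<in> U \<longleftrightarrow> u \<in> carrier_vec n \<and> T *\<^sub>v u = 0\<^sub>v m" for u by blast
  have "{u \<in> W. T *\<^sub>v u = 0\<^sub>v m} = U" using UW vec_subspaceD(1)[OF W] ker by auto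
  then have rn: "subspace_dim m ((*\<^sub>v) T ` W) + subspace_dim n U = subspace_dim n W"
    using rank_nullity_mat(2)[OF T W] by simp
  then show "subspace_dim n U \<le> subspace_dim n W" by simp
  assume "subspace_dim n U = subspace_dim n W"
  then have "(*\<^sub>v) T ` W = {0\<^sub>v m}"
    using rn subspace_dim_eq_0[OF rank_nullity_mat(1)[OF T W]] by simp
  then show "U = W" using UW vec_subspaceD(1)[OF W] ker by auto
qed

section \<open>Shrunk subspaces and invariance\<close>

lemma matrix_lie_algebraD:
  assumes "matrix_lie_algebra n \<B>"
  shows "\<B> \<subseteq> carrier_mat n n" "0\<^sub>m n n \<in> \<B>" "\<And>A B. A \<in> \<B> \<Longrightarrow> B \<in> \<B> \<Longrightarrow> A + B \<in> \<B>"
    "\<And>c A. A \<in> \<B> \<Longrightarrow> c \<cdot>\<^sub>m A \<in> \<B>" "\<And>A B. A \<in> \<B> \<Longrightarrow> B \<in> \<B> \<Longrightarrow> A * B - B * A \<in> \<B>"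
  using assms unfolding matrix_lie_algebra_def mat_subspace_iff by blast+

lemma matrix_lie_algebraI:
  assumes "\<B> \<subseteq> carrier_mat n n" "0\<^sub>m n n \<in> \<B>" "\<And>A B. A \<in> \<B> \<Longrightarrow> B \<in> \<B> \<Longrightarrow> A + B \<in> \<B>"
    "\<And>c A. A \<in> \<B> \<Longrightarrow> c \<cdot>\<^sub>m A \<in> \<B>" "\<And>A B. A \<in> \<B> \<Longrightarrow> B \<in> \<B> \<Longrightarrow> A * B - B * A \<in> \<B>"
  shows "matrix_lie_algebra n \<B>"
  using assms unfolding matrix_lie_algebra_def mat_subspace_iff by blast

section \<open>The space spanned by the products of an algebra with a subspace\<close>

context
  fixes n :: nat and \<B> :: "'a :: field mat set" and U :: "'a vec set"
  assumes \<B>: "\<B> \<subseteq> carrier_mat n n" and U: "U \<subseteq> carrier_vec n"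
begin

lemma action_subset_carrier: "{B *\<^sub>v u | B u. B \<in> \<B> \<and> u \<in> U} \<subseteq> carrier_vec n"
  using \<B> U by (auto intro!: mult_mat_vec_carrier)

lemma action_span_subspace: "vec_subspace n (action_span n \<B> U)"
proof -
  interpret vec_space "TYPE('a)" n .
  show ?thesis
    unfolding vec_subspace_def action_span_def
    using span_is_subspace action_subset_carrier by simp
qed

lemma action_in_action_span: "B \<in> \<B> \<Longrightarrow> u \<in> U \<Longrightarrow> B *\<^sub>v u \<in> action_span n \<B> U"
proof -
  interpret vec_space "TYPE('a)" n .
  show "B \<in> \<B> \<Longrightarrow> u \<in> U \<Longrightarrow> B *\<^sub>v u \<in> action_span n \<B> U"
    unfolding action_span_def using in_own_span[OF action_subset_carrier] by blast
qed

lemma action_span_minimal: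
  assumes W: "vec_subspace n W" and "\<And>B u. B \<in> \<B> \<Longrightarrow> u \<in> U \<Longrightarrow> B *\<^sub>v u \<in> W"
  shows "action_span n \<B> U \<subseteq> W"
proof -
  interpret vec_space "TYPE('a)" n .
  have "submodule class_ring W V" using W by (auto simp: vec_subspace_def subspace_def)
  then show ?thesis
    unfolding action_span_def using assms(2) by (intro span_is_subset) auto
qed

end

lemma subspace_dim_le: "vec_subspace n U \<Longrightarrow> subspace_dim n U \<le> n"
  using subspace_dim_mono(1)[OF _ vec_subspace_carrier] vec_subspaceD(1) subspace_dim_carrier by metis

lemma shrunk_imp_invariant_shrunk:
  fixes \<B> :: "'a :: field mat set"
  assumes lie: "matrix_lie_algebra n \<B>" and shrunk: "has_shrunk_subspace n \<B>"
  obtains U where "shrunk_subspace n \<B> U" "invariant_subspace n \<B> U"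
proof -
  note \<B> = matrix_lie_algebraD[OF lie]
  \<comment> \<open>The subtraction of natural numbers truncates negative differences to 0, so
    \<open>f U > 0\<close> holds exactly when the dimension drops strictly.\<close>
  define f where "f = (\<lambda>U. subspace_dim n U - subspace_dim n (action_span n \<B> U))"
  obtain U0 where U0: "vec_subspace n U0" "f U0 > 0"
    using shrunk by (auto simp: has_shrunk_subspace_def shrunk_subspace_def f_def)
  have bound: "f U < Suc n" if "vec_subspace n U" for U
    using subspace_dim_le[OF that] by (simp add: f_def)
  obtain U1 where U1: "vec_subspace n U1" "\<And>U. vec_subspace n U \<Longrightarrow> f U \<le> f U1"
    using ex_has_greatest_nat[of "vec_subspace n" U0 f "Suc n"] U0 bound by blast
  \<comment> \<open>\<open>P\<close> singles out the maximisers of \<open>f\<close>; minimal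
    dimension among them is what will force invariance.\<close>
  define P where "P = (\<lambda>U. vec_subspace n U \<and> f U = f U1)"
  obtain U where "P U" and least: "\<And>U'. P U' \<Longrightarrow> subspace_dim n U \<le> subspace_dim n U'"
    using ex_has_least_nat[of P U1 "subspace_dim n"] U1 by (auto simp: P_def)
  then have U: "vec_subspace n U" and fU: "f U = f U1" by (auto simp: P_def)
  have pos: "f U > 0" using U0 U1(2)[OF U0(1)] fU by simp
  have max: "f U' \<le> f U" if "vec_subspace n U'" for U' using U1(2)[OF that] fU by simp
  note UD = vec_subspaceD[OF U]
  define W where "W = action_span n \<B> U"
  have W: "vec_subspace n W" unfolding W_def by (rule action_span_subspace[OF \<B>(1) UD(1)])
  note WD = vec_subspaceD[OF W]
  have BU: "B *\<^sub>v u \<in> W" if "B \<in> \<B>" "u \<in> U" for B u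
    unfolding W_def using that by (rule action_in_action_span[OF \<B>(1) UD(1)])
  have stable: "b *\<^sub>v u \<in> U" if b: "b \<in> \<B>" and u: "u \<in> U" for b u
  proof -
    have bc: "b \<in> carrier_mat n n" using b \<B>(1) by auto
    define Ui where "Ui = {u \<in> U. b *\<^sub>v u \<in> U}"
    define Us where "Us = {u + b *\<^sub>v v | u v. u \<in> U \<and> v \<in> U}"
    define Wi where "Wi = {u \<in> W. b *\<^sub>v u \<in> W}"
    define Ws where "Ws = {u + b *\<^sub>v v | u v. u \<in> W \<and> v \<in> W}"
    note dU = dim_preimage_plus_dim_sum[OF bc U, folded Ui_def Us_def]
    note dW = dim_preimage_plus_dim_sum[OF bc W, folded Wi_def Ws_def]
    have "action_span n \<B> Ui \<subseteq> Wi"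
    proof (rule action_span_minimal[OF \<B>(1) _ dW(1)])
      fix c u assume c: "c \<in> \<B>" and "u \<in> Ui"
      then have u: "u \<in> U" "b *\<^sub>v u \<in> U" by (auto simp: Ui_def)
      have carr: "c \<in> carrier_mat n n" "u \<in> carrier_vec n" using c u \<B>(1) UD(1) by auto
      \<comment> \<open>Since \<open>b *\<^sub>v u\<close> lies in \<open>U\<close>, both
        \<open>c *\<^sub>v (b *\<^sub>v u)\<close> and the commutator term lie in
        \<open>W\<close>.\<close>
      have "b *\<^sub>v (c *\<^sub>v u) = c *\<^sub>v (b *\<^sub>v u) + (b * c - c * b) *\<^sub>v u"
        using bc carr by (subst minus_mult_distrib_mat_vec[of _ n n]) (auto simp: assoc_mult_mat_vec[of _ n n _ n])
      also have "\<dots> \<in> W" using BU c u b \<B>(5) by (intro WD(3)) auto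
      finally show "c *\<^sub>v u \<in> Wi" using BU c u by (auto simp: Wi_def)
    qed (use vec_subspaceD(1)[OF dU(1)] in simp)
    then have le1: "subspace_dim n (action_span n \<B> Ui) \<le> subspace_dim n Wi"
      by (intro subspace_dim_mono(1) action_span_subspace \<B>(1) vec_subspaceD(1)[OF dU(1)] dW(1))
    have "action_span n \<B> Us \<subseteq> Ws"
    proof (rule action_span_minimal[OF \<B>(1) _ dW(2)])
      fix c x assume c: "c \<in> \<B>" and "x \<in> Us"
      then obtain u v where x: "x = u + b *\<^sub>v v" and u: "u \<in> U" "v \<in> U" by (auto simp: Us_def)
      have carr: "c \<in> carrier_mat n n" "u \<in> carrier_vec n" "v \<in> carrier_vec n" using c u \<B>(1) UD(1) by auto
      \<comment> \<open>Moving \<open>c\<close> past \<open>b\<close> costs a commutator applied to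
        \<open>v\<close>, which again lies in \<open>W\<close> and is absorbed by the first
        summand.\<close>
      have "c *\<^sub>v x = (c *\<^sub>v u + (c * b - b * c) *\<^sub>v v) + b *\<^sub>v (c *\<^sub>v v)"
        using bc carr unfolding x
        by (subst minus_mult_distrib_mat_vec[of _ n n])
          (auto simp: assoc_mult_mat_vec[of _ n n _ n] mult_add_distrib_mat_vec[of _ n n])
      moreover have "c *\<^sub>v u + (c * b - b * c) *\<^sub>v v \<in> W"
        using BU c u b \<B>(5) by (intro WD(3)) auto
      moreover have "c *\<^sub>v v \<in> W" using BU c u by auto
      ultimately show "c *\<^sub>v x \<in> Ws" unfolding Ws_def by blast
    qed (use vec_subspaceD(1)[OF dU(2)] in simp)
    then have le2: "subspace_dim n (action_span n \<B> Us) \<le> subspace_dim n Ws"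
      by (intro subspace_dim_mono(1) action_span_subspace \<B>(1) vec_subspaceD(1)[OF dU(2)] dW(2))
    \<comment> \<open>By the two dimension formulas with \<open>le1\<close> and \<open>le2\<close>,
      \<open>f Ui + f Us\<close> is at least \<open>2 * f U\<close>; as neither summand exceeds
      \<open>f U\<close>, both equal it. Here \<open>pos\<close> ensures that \<open>f U\<close> is
      the true difference and not a truncated one.\<close>
    have "f Us \<le> f U" "f Ui \<le> f U" using max dU by auto
    then have "f Ui = f U"
      using le1 le2 dU(3) dW(3) pos unfolding f_def W_def[symmetric] by linarith
    then have "P Ui" using dU(1) fU by (simp add: P_def)
    then have "subspace_dim n U \<le> subspace_dim n Ui" by (rule least)
    moreover have sub: "Ui \<subseteq> U" by (auto simp: Ui_def)
    ultimately have "Ui = U" using subspace_dim_mono[OF dU(1) U] by simp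
    then show ?thesis using u by (auto simp: Ui_def)
  qed
  show thesis
    by (rule that[of U]) (use stable pos U in \<open>auto simp: shrunk_subspace_def invariant_subspace_def f_def\<close>)
qed

lemma irreducible_shrunk_imp_trivial:
  fixes \<B> :: "'a :: field mat set"
  assumes irr: "irreducible_matrix_lie_algebra n \<B>" and shrunk: "has_shrunk_subspace n \<B>"
  shows "trivial_irreducible n \<B>"
proof -
  have lie: "matrix_lie_algebra n \<B>"
    and irrD: "\<And>U. invariant_subspace n \<B> U \<Longrightarrow> U = {0\<^sub>v n} \<or> U = carrier_vec n"
    using irr by (auto simp: irreducible_matrix_lie_algebra_def)
  note \<B> = matrix_lie_algebraD[OF lie]
  obtain U where U: "shrunk_subspace n \<B> U" "invariant_subspace n \<B> U"
    by (rule shrunk_imp_invariant_shrunk[OF lie shrunk])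
  define W where "W = action_span n \<B> U"
  have dim: "subspace_dim n W < subspace_dim n U" using U(1) by (simp add: shrunk_subspace_def W_def)
  \<comment> \<open>The zero space is excluded because \<open>U\<close> has positive
    dimension.\<close>
  have UV: "U = carrier_vec n" using irrD[OF U(2)] dim subspace_dim_zero by (metis not_less_zero)
  have W: "vec_subspace n W" unfolding W_def by (rule action_span_subspace[OF \<B>(1)]) (simp add: UV)
  have BW: "B *\<^sub>v u \<in> W" if "B \<in> \<B>" "u \<in> carrier_vec n" for B u
    unfolding W_def using that by (intro action_in_action_span[OF \<B>(1)]) (auto simp: UV)
  have "invariant_subspace n \<B> W"
    using W BW vec_subspaceD(1)[OF W] by (auto simp: invariant_subspace_def)
  then have W0: "W = {0\<^sub>v n}" using irrD dim UV by blast
  \<comment> \<open>All of \<open>\<B>\<close> maps into \<open>W = 0\<close>; applying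
    \<open>B\<close> to the unit vectors reads off its columns.\<close>
  have "B = 0\<^sub>m n n" if "B \<in> \<B>" for B
  proof (rule eq_matI)
    fix i j assume ij: "i < dim_row (0\<^sub>m n n)" "j < dim_col (0\<^sub>m n n)"
    have B: "B \<in> carrier_mat n n" using that \<B>(1) by auto
    have "B *\<^sub>v unit_vec n j = 0\<^sub>v n" using BW[OF that, of "unit_vec n j"] W0 by auto
    moreover have "(B *\<^sub>v unit_vec n j) $ i = B $$ (i, j)"
      using ij B by (simp add: scalar_prod_right_unit)
    ultimately show "B $$ (i, j) = 0\<^sub>m n n $$ (i, j)" using ij by simp
  qed (use that \<B>(1) in auto)
  then have B0: "\<B> = {0\<^sub>m n n}" using \<B>(2) by blast
  have n: "1 \<le> n" using dim UV subspace_dim_carrier[of n, where 'a = 'a] by simp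
  \<comment> \<open>The zero algebra leaves every subspace invariant, in particular this coordinate
    line. Irreducibility then forces the line to be the whole space, so
    \<open>n = 1\<close>.\<close>
  define E :: "'a vec set" where "E = coord_subspace n 1 (1\<^sub>m n)"
  have E: "vec_subspace n E" unfolding E_def by (rule coord_subspace_is_subspace) simp
  have "0\<^sub>m n n *\<^sub>v x = 0\<^sub>v n" if "x \<in> carrier_vec n" for x :: "'a vec"
    using that by (intro eq_vecI) auto
  then have "invariant_subspace n \<B> E"
    using E vec_subspaceD(1,2)[OF E] by (auto simp: invariant_subspace_def B0 subset_iff)
  moreover have "subspace_dim n E = 1"
    unfolding E_def using n by (intro coord_subspace_dim[of "1\<^sub>m n"]) auto
  ultimately have "n = 1"
    using irrD subspace_dim_zero[of n, where 'a = 'a] subspace_dim_carrier[of n, where 'a = 'a] by fastforce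
  then show ?thesis using B0 by (simp add: trivial_irreducible_def)
qed

section \<open>Block triangular Lie algebras\<close>

lemma block_start_Suc: "i < length ds \<Longrightarrow> block_start ds (Suc i) = block_start ds i + ds ! i"
  by (simp add: block_start_def take_Suc_conv_app_nth)

lemma block_start_mono: "i \<le> j \<Longrightarrow> block_start ds i \<le> block_start ds j"
  by (metis block_start_def le_add1 le_add_diff_inverse sum_list_append take_add)

lemma block_start_le: "block_start ds i \<le> sum_list ds"
  unfolding block_start_def by (metis append_take_drop_id le_add1 sum_list_append)

lemma block_start_append1: "i \<le> length ds1 \<Longrightarrow> block_start (ds1 @ ds2) i = block_start ds1 i"
  by (simp add: block_start_def)

lemma block_start_append2: "block_start (ds1 @ ds2) (length ds1 + i) = sum_list ds1 + block_start ds2 i"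
  by (simp add: block_start_def)

text \<open>The block sought ends at the least boundary beyond \<open>r\<close>. That boundary is
  not the zeroth one, which is 0, so it has a predecessor.\<close>

lemma block_index_exists:
  assumes "r < sum_list ds"
  shows "\<exists>i<length ds. block_start ds i \<le> r \<and> r < block_start ds (Suc i)"
proof -
  have ex: "r < block_start ds (length ds)" using assms by (simp add: block_start_def)
  define j where "j = (LEAST j. r < block_start ds j)"
  have j: "r < block_start ds j" unfolding j_def by (rule LeastI) (rule ex)
  have "j \<noteq> 0"
  proof
    assume "j = 0"
    with j show False by (simp add: block_start_def)
  qed
  then obtain i where i: "j = Suc i" using not0_implies_Suc by blast
  then have "block_start ds i \<le> r"
    using not_less_Least[of i "\<lambda>j. r < block_start ds j"] by (auto simp: j_def)
  moreover have "j \<le> length ds" unfolding j_def by (rule Least_le) (rule ex)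
  ultimately show ?thesis using i j Suc_le_lessD by blast
qed

section \<open>Matrices with two diagonal blocks and a zero lower left corner\<close>

definition upper_left :: "nat \<Rightarrow> 'a mat \<Rightarrow> 'a mat" where
  "upper_left k M = mat k k (\<lambda>(i, j). M $$ (i, j))"

definition lower_right :: "nat \<Rightarrow> nat \<Rightarrow> 'a mat \<Rightarrow> 'a mat" where
  "lower_right k m M = mat m m (\<lambda>(i, j). M $$ (k + i, k + j))"

text \<open>Either size may be 0, in contrast to the blocks of a composition form. This covers an
  invariant subspace that is zero or the whole space without a separate case.\<close>

definition two_block_triangular :: "nat \<Rightarrow> nat \<Rightarrow> 'a :: zero mat \<Rightarrow> bool" where
  "two_block_triangular k m M \<longleftrightarrow>
     M \<in> carrier_mat (k + m) (k + m) \<and> (\<forall>i<m. \<forall>j<k. M $$ (k + i, j) = 0)"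

lemma upper_left_carrier [simp]: "upper_left k M \<in> carrier_mat k k"
  by (simp add: upper_left_def)

lemma lower_right_carrier [simp]: "lower_right k m M \<in> carrier_mat m m"
  by (simp add: lower_right_def)

lemma upper_left_four_block [simp]:
  "X \<in> carrier_mat k k \<Longrightarrow> W \<in> carrier_mat m m \<Longrightarrow> upper_left k (four_block_mat X Y Z W) = X"
  by (intro eq_matI) (auto simp: upper_left_def)

lemma lower_right_four_block [simp]:
  "X \<in> carrier_mat k k \<Longrightarrow> W \<in> carrier_mat m m \<Longrightarrow> lower_right k m (four_block_mat X Y Z W) = W"
  by (intro eq_matI) (auto simp: lower_right_def)

lemma two_block_triangularE:
  assumes "two_block_triangular k m M"
  obtains Y where "Y \<in> carrier_mat k m"
    "M = four_block_mat (upper_left k M) Y (0\<^sub>m m k) (lower_right k m M)"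
proof -
  define Y where "Y = mat k m (\<lambda>(i, j). M $$ (i, k + j))"
  have "M = four_block_mat (upper_left k M) Y (0\<^sub>m m k) (lower_right k m M)"
  proof (rule eq_matI)
    fix i j assume ij: "i < dim_row (four_block_mat (upper_left k M) Y (0\<^sub>m m k) (lower_right k m M))"
      "j < dim_col (four_block_mat (upper_left k M) Y (0\<^sub>m m k) (lower_right k m M))"
    have "M $$ (i, j) = 0" if "\<not> i < k" "j < k"
    proof -
      have "i - k < m" "k + (i - k) = i" using ij that by (auto simp: upper_left_def lower_right_def)
      then show ?thesis using assms that unfolding two_block_triangular_def by metis
    qed
    then show "M $$ (i, j) = four_block_mat (upper_left k M) Y (0\<^sub>m m k) (lower_right k m M) $$ (i, j)"
      using ij by (auto simp: upper_left_def lower_right_def Y_def)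
  qed (use assms in \<open>auto simp: two_block_triangular_def upper_left_def lower_right_def\<close>)
  then show thesis by (intro that[of Y]) (simp add: Y_def)
qed

text \<open>The zero corner removes the cross terms from the diagonal blocks of a product. Hence
  passing to a diagonal block respects commutators.\<close>

lemma two_block_mult:
  fixes M N :: "'a :: semiring_0 mat"
  assumes M: "two_block_triangular k m M" and N: "two_block_triangular k m N"
  shows "upper_left k (M * N) = upper_left k M * upper_left k N"
    and "lower_right k m (M * N) = lower_right k m M * lower_right k m N"
proof -
  let ?X = "upper_left k" and ?W = "lower_right k m"
  obtain Y where Y: "Y \<in> carrier_mat k m" and Meq: "M = four_block_mat (?X M) Y (0\<^sub>m m k) (?W M)"
    by (rule two_block_triangularE[OF M])
  obtain Y' where Y': "Y' \<in> carrier_mat k m" and Neq: "N = four_block_mat (?X N) Y' (0\<^sub>m m k) (?W N)"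
    by (rule two_block_triangularE[OF N])
  have "M * N = four_block_mat (?X M) Y (0\<^sub>m m k) (?W M) * four_block_mat (?X N) Y' (0\<^sub>m m k) (?W N)"
    using Meq Neq by simp
  also have "\<dots> = four_block_mat (?X M * ?X N + Y * 0\<^sub>m m k) (?X M * Y' + Y * ?W N)
      (0\<^sub>m m k * ?X N + ?W M * 0\<^sub>m m k) (0\<^sub>m m k * Y' + ?W M * ?W N)"
    by (rule mult_four_block_mat) (use Y Y' in auto)
  finally have eq: "M * N = \<dots>" .
  have XX: "?X M * ?X N \<in> carrier_mat k k" and WW: "?W M * ?W N \<in> carrier_mat m m"
    by (intro mult_carrier_mat[of _ _ k] mult_carrier_mat[of _ _ m] upper_left_carrier lower_right_carrier)+
  show "?X (M * N) = ?X M * ?X N"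
    unfolding eq using XX WW Y Y' by (subst upper_left_four_block[of _ _ _ m]) auto
  show "?W (M * N) = ?W M * ?W N"
    unfolding eq using XX WW Y Y' by (subst lower_right_four_block) auto
qed

lemma upper_left_linear:
  assumes "M \<in> carrier_mat (k + m) (k + m)" "N \<in> carrier_mat (k + m) (k + m)"
  shows "upper_left k (M + N) = upper_left k M + upper_left k N"
    "upper_left k (M - N) = upper_left k M - upper_left k N"
  using assms by (auto simp: upper_left_def)

lemma upper_left_smult:
  assumes "M \<in> carrier_mat (k + m) (k + m)"
  shows "upper_left k (c \<cdot>\<^sub>m M) = c \<cdot>\<^sub>m upper_left k M"
  using assms by (auto simp: upper_left_def)

lemma lower_right_linear:
  assumes "M \<in> carrier_mat (k + m) (k + m)" "N \<in> carrier_mat (k + m) (k + m)"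
  shows "lower_right k m (M + N) = lower_right k m M + lower_right k m N"
    "lower_right k m (M - N) = lower_right k m M - lower_right k m N"
  using assms by (auto simp: lower_right_def)

lemma lower_right_smult:
  assumes "M \<in> carrier_mat (k + m) (k + m)"
  shows "lower_right k m (c \<cdot>\<^sub>m M) = c \<cdot>\<^sub>m lower_right k m M"
  using assms by (auto simp: lower_right_def)

lemma matrix_lie_algebra_image:
  fixes \<B> :: "'a :: field mat set"
  assumes lie: "matrix_lie_algebra n \<B>"
    and carr: "\<And>A. A \<in> \<B> \<Longrightarrow> \<phi> A \<in> carrier_mat d d"
    and add: "\<And>A B. A \<in> \<B> \<Longrightarrow> B \<in> \<B> \<Longrightarrow> \<phi> (A + B) = \<phi> A + \<phi> B"
    and smult: "\<And>c A. A \<in> \<B> \<Longrightarrow> \<phi> (c \<cdot>\<^sub>m A) = c \<cdot>\<^sub>m \<phi> A"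
    and comm: "\<And>A B. A \<in> \<B> \<Longrightarrow> B \<in> \<B> \<Longrightarrow> \<phi> (A * B - B * A) = \<phi> A * \<phi> B - \<phi> B * \<phi> A"
  shows "matrix_lie_algebra d (\<phi> ` \<B>)"
proof -
  note \<B> = matrix_lie_algebraD[OF lie]
  \<comment> \<open>That the zero matrix is in the image follows from homogeneity with the scalar
    0.\<close>
  have "0\<^sub>m d d = 0 \<cdot>\<^sub>m \<phi> (0\<^sub>m n n)"
    using carr[OF \<B>(2)] by (intro eq_matI) auto
  also have "\<dots> = \<phi> (0 \<cdot>\<^sub>m 0\<^sub>m n n)" using smult[OF \<B>(2)] by simp
  finally have "0\<^sub>m d d \<in> \<phi> ` \<B>" using \<B>(4)[OF \<B>(2)] by blast
  then show ?thesis
  proof (rule matrix_lie_algebraI[rotated])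
    fix X Y assume "X \<in> \<phi> ` \<B>" "Y \<in> \<phi> ` \<B>"
    then obtain A B where AB: "A \<in> \<B>" "B \<in> \<B>" "X = \<phi> A" "Y = \<phi> B" by blast
    show "X + Y \<in> \<phi> ` \<B>" unfolding AB(3,4) add[OF AB(1,2), symmetric] by (intro imageI \<B>(3) AB)
    show "X * Y - Y * X \<in> \<phi> ` \<B>" unfolding AB(3,4) comm[OF AB(1,2), symmetric] by (intro imageI \<B>(5) AB)
  next
    fix c X assume "X \<in> \<phi> ` \<B>"
    then show "c \<cdot>\<^sub>m X \<in> \<phi> ` \<B>" using \<B>(4) smult by (metis image_iff)
  qed (use carr in auto)
qed

lemma matrix_lie_algebra_diagonal_blocks:
  fixes \<B> :: "'a :: field mat set"
  assumes lie: "matrix_lie_algebra (k + m) \<B>" and tri: "\<And>B. B \<in> \<B> \<Longrightarrow> two_block_triangular k m B"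
  shows "matrix_lie_algebra k (upper_left k ` \<B>)" "matrix_lie_algebra m (lower_right k m ` \<B>)"
proof -
  note \<B> = matrix_lie_algebraD[OF lie]
  have carr: "B \<in> carrier_mat (k + m) (k + m)" if "B \<in> \<B>" for B using \<B>(1) that by auto
  show "matrix_lie_algebra k (upper_left k ` \<B>)"
  proof (rule matrix_lie_algebra_image[OF lie])
    fix A B assume AB: "A \<in> \<B>" "B \<in> \<B>"
    then have "A * B \<in> carrier_mat (k + m) (k + m)" "B * A \<in> carrier_mat (k + m) (k + m)"
      using carr by (auto intro: mult_carrier_mat)
    then show "upper_left k (A * B - B * A) = upper_left k A * upper_left k B - upper_left k B * upper_left k A"
      using AB by (simp add: upper_left_linear(2)[of _ k m] two_block_mult(1)[OF tri tri])
  qed (auto simp: upper_left_linear(1)[OF carr carr] upper_left_smult[OF carr])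
  show "matrix_lie_algebra m (lower_right k m ` \<B>)"
  proof (rule matrix_lie_algebra_image[OF lie])
    fix A B assume AB: "A \<in> \<B>" "B \<in> \<B>"
    then have "A * B \<in> carrier_mat (k + m) (k + m)" "B * A \<in> carrier_mat (k + m) (k + m)"
      using carr by (auto intro: mult_carrier_mat)
    then show "lower_right k m (A * B - B * A) = lower_right k m A * lower_right k m B - lower_right k m B * lower_right k m A"
      using AB by (simp add: lower_right_linear(2)[of _ k m] two_block_mult(2)[OF tri tri])
  qed (auto simp: lower_right_linear(1)[OF carr carr] lower_right_smult[OF carr])
qed

section \<open>Change of basis\<close>

lemma conjugate_mult:
  fixes P :: "'a :: semiring_1 mat"
  assumes "P \<in> carrier_mat n n" "Q \<in> carrier_mat n n" "P * Q = 1\<^sub>m n"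
    "A \<in> carrier_mat n n" "B \<in> carrier_mat n n"
  shows "(Q * A * P) * (Q * B * P) = Q * (A * B) * P"
proof -
  have "(Q * A * P) * (Q * B * P) = Q * A * (P * Q) * (B * P)"
    using assms(1,2,4,5) by (simp add: assoc_mult_mat[of _ n n _ n _ n] mult_carrier_mat[of _ n n _ n])
  then show ?thesis
    using assms by (simp add: assoc_mult_mat[of _ n n _ n _ n] mult_carrier_mat[of _ n n _ n])
qed

lemma matrix_lie_algebra_conjugate:
  fixes \<B> :: "'a :: field mat set"
  assumes lie: "matrix_lie_algebra n \<B>"
    and P: "P \<in> carrier_mat n n" and Q: "Q \<in> carrier_mat n n" and PQ: "P * Q = 1\<^sub>m n"
  shows "matrix_lie_algebra n ((\<lambda>B. Q * B * P) ` \<B>)"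
proof (rule matrix_lie_algebra_image[OF lie])
  note \<B> = matrix_lie_algebraD[OF lie]
  have carr: "B \<in> carrier_mat n n" if "B \<in> \<B>" for B using \<B>(1) that by auto
  have QB: "Q * B \<in> carrier_mat n n" if "B \<in> carrier_mat n n" for B using Q that by auto
  fix A B assume A: "A \<in> \<B>"
  note A' = carr[OF A]
  show "Q * A * P \<in> carrier_mat n n" using A' P Q by auto
  show "Q * (c \<cdot>\<^sub>m A) * P = c \<cdot>\<^sub>m (Q * A * P)" for c
    using A' P Q by (simp add: mult_smult_distrib[of _ n n _ n] mult_smult_assoc_mat[of _ n n _ n])
  assume B: "B \<in> \<B>"
  note B' = carr[OF B]
  show "Q * (A + B) * P = Q * A * P + Q * B * P"
    using A' B' P Q by (simp add: mult_add_distrib_mat[of _ n n] add_mult_distrib_mat[of _ n n])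
  have "A * B \<in> carrier_mat n n" "B * A \<in> carrier_mat n n" using A' B' by auto
  then have "Q * (A * B - B * A) * P = Q * (A * B) * P - Q * (B * A) * P"
    using P Q QB by (simp add: mult_minus_distrib_mat[of _ n n] minus_mult_distrib_mat[of _ n n])
  then show "Q * (A * B - B * A) * P = (Q * A * P) * (Q * B * P) - (Q * B * P) * (Q * A * P)"
    using conjugate_mult[OF P Q PQ] A' B' by simp
qed

section \<open>Composition factors\<close>

lemma diagonal_block_span_eq:
  assumes "(ds ! i) = (es ! j)" "diagonal_block ds i ` S = diagonal_block es j ` T"
  shows "diagonal_block_span ds i S = diagonal_block_span es j T"
  using assms by (simp add: diagonal_block_span_def)

lemma diagonal_block_carrier [simp]: "diagonal_block ds i M \<in> carrier_mat (ds ! i) (ds ! i)"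
  by (simp add: diagonal_block_def)

lemma diagonal_block_in_span:
  assumes "M \<in> S"
  shows "diagonal_block ds i M \<in> diagonal_block_span ds i S"
proof -
  interpret vectorspace class_ring "module_mat TYPE('a) (ds ! i) (ds ! i)" by (rule matrix_vs)
  have "diagonal_block ds i ` S \<subseteq> carrier (module_mat TYPE('a) (ds ! i) (ds ! i))"
    by (auto simp: module_mat_simps)
  from in_own_span[OF this] show ?thesis
    using assms unfolding diagonal_block_span_def by blast
qed

lemma span_matrix_lie_algebra:
  assumes "matrix_lie_algebra n \<B>"
  shows "LinearCombinations.module.span class_ring (module_mat TYPE('a :: field) n n) \<B> = \<B>"
proof -
  interpret vectorspace class_ring "module_mat TYPE('a) n n" by (rule matrix_vs)
  have "submodule class_ring \<B> (module_mat TYPE('a) n n)"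
    using assms by (auto simp: matrix_lie_algebra_def subspace_def)
  moreover have "\<B> \<subseteq> carrier (module_mat TYPE('a) n n)"
    using matrix_lie_algebraD(1)[OF assms] by (simp add: module_mat_simps)
  ultimately show ?thesis using in_own_span span_is_subset by blast
qed

lemma composition_formD:
  assumes "composition_form n \<B> A A' ds"
  shows "A \<in> carrier_mat n n" "A' \<in> carrier_mat n n" "A * A' = 1\<^sub>m n" "A' * A = 1\<^sub>m n"
    "\<And>d. d \<in> set ds \<Longrightarrow> d > 0" "sum_list ds = n"
    "\<And>B. B \<in> \<B> \<Longrightarrow> block_upper_triangular ds (A' * B * A)"
    "\<And>i. i < length ds \<Longrightarrow> irreducible_matrix_lie_algebra (ds ! i)
       (diagonal_block_span ds i ((\<lambda>B. A' * B * A) ` \<B>))"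
  using assms unfolding composition_form_def inverts_mat_def by auto

lemma composition_form_irreducible:
  fixes \<B> :: "'a :: field mat set"
  assumes irr: "irreducible_matrix_lie_algebra n \<B>" and n: "n > 0"
  shows "composition_form n \<B> (1\<^sub>m n) (1\<^sub>m n) [n]"
    and "diagonal_block_span [n] 0 ((\<lambda>B. 1\<^sub>m n * B * 1\<^sub>m n) ` \<B>) = \<B>"
proof -
  have lie: "matrix_lie_algebra n \<B>" using irr by (simp add: irreducible_matrix_lie_algebra_def)
  have carr: "B \<in> carrier_mat n n" if "B \<in> \<B>" for B using matrix_lie_algebraD(1)[OF lie] that by auto
  have "diagonal_block [n] 0 (1\<^sub>m n * B * 1\<^sub>m n) = B" if "B \<in> \<B>" for B
    using carr[OF that] by (intro eq_matI) (auto simp: diagonal_block_def block_start_def)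
  then have "diagonal_block [n] 0 ` (\<lambda>B. 1\<^sub>m n * B * 1\<^sub>m n) ` \<B> = \<B>"
    by (simp add: image_image)
  then show span: "diagonal_block_span [n] 0 ((\<lambda>B. 1\<^sub>m n * B * 1\<^sub>m n) ` \<B>) = \<B>"
    unfolding diagonal_block_span_def using span_matrix_lie_algebra[OF lie] by simp
  show "composition_form n \<B> (1\<^sub>m n) (1\<^sub>m n) [n]"
    unfolding composition_form_def
    using n irr span by (auto simp: inverts_mat_def block_upper_triangular_def block_start_def)
qed

text \<open>Conjugation by \<open>P\<close> splits \<open>\<B>\<close> into its actions on an
  invariant subspace and on the quotient; a block diagonal base change then brings both into
  composition form. The identities for the spans are recorded so that a given factor of either part
  can be located in the concatenated list.\<close>

lemma composition_form_append:
  fixes \<B> :: "'a :: field mat set"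
  assumes P: "P \<in> carrier_mat (k + m) (k + m)" and Q: "Q \<in> carrier_mat (k + m) (k + m)"
    and PQ: "P * Q = 1\<^sub>m (k + m)" and QP: "Q * P = 1\<^sub>m (k + m)"
    and \<B>: "\<B> \<subseteq> carrier_mat (k + m) (k + m)"
    and tri: "\<And>B. B \<in> \<B> \<Longrightarrow> two_block_triangular k m (Q * B * P)"
    and form1: "composition_form k ((\<lambda>B. upper_left k (Q * B * P)) ` \<B>) A1 A1' ds1"
    and form2: "composition_form m ((\<lambda>B. lower_right k m (Q * B * P)) ` \<B>) A2 A2' ds2"
  obtains A A' where "composition_form (k + m) \<B> A A' (ds1 @ ds2)"
    and "\<forall>i<length ds1. diagonal_block_span (ds1 @ ds2) i ((\<lambda>B. A' * B * A) ` \<B>) =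
      diagonal_block_span ds1 i ((\<lambda>B. A1' * B * A1) ` (\<lambda>B. upper_left k (Q * B * P)) ` \<B>)"
    and "\<forall>i<length ds2. diagonal_block_span (ds1 @ ds2) (length ds1 + i) ((\<lambda>B. A' * B * A) ` \<B>) =
      diagonal_block_span ds2 i ((\<lambda>B. A2' * B * A2) ` (\<lambda>B. lower_right k m (Q * B * P)) ` \<B>)"
proof -
  note f1 = composition_formD[OF form1] and f2 = composition_formD[OF form2]
  let ?n = "k + m"
  define D where "D = four_block_mat A1 (0\<^sub>m k m) (0\<^sub>m m k) A2"
  define D' where "D' = four_block_mat A1' (0\<^sub>m k m) (0\<^sub>m m k) A2'"
  have D: "D \<in> carrier_mat ?n ?n" unfolding D_def using f1(1) f2(1) by simp
  have D': "D' \<in> carrier_mat ?n ?n" unfolding D'_def using f1(2) f2(2) by simp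
  have DD': "D * D' = 1\<^sub>m ?n" unfolding D_def D'_def
    by (subst mult_four_block_mat) (use f1(1-4) f2(1-4) in auto)
  have D'D: "D' * D = 1\<^sub>m ?n" unfolding D_def D'_def
    by (subst mult_four_block_mat) (use f1(1-4) f2(1-4) in auto)
  define A where "A = P * D"
  define A' where "A' = D' * Q"
  have A: "A \<in> carrier_mat ?n ?n" "A' \<in> carrier_mat ?n ?n"
    unfolding A_def A'_def using P Q D D' by auto
  note assoc = assoc_mult_mat[of _ ?n ?n _ ?n _ ?n] and closed = mult_carrier_mat[of _ ?n ?n _ ?n]
  have AA': "A * A' = 1\<^sub>m ?n"
  proof -
    have "A * A' = P * (D * D') * Q" unfolding A_def A'_def using P Q D D' by (simp add: assoc closed)
    then show ?thesis using DD' PQ P by simp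
  qed
  have A'A: "A' * A = 1\<^sub>m ?n"
  proof -
    have "A' * A = D' * (Q * P) * D" unfolding A_def A'_def using P Q D D' by (simp add: assoc closed)
    then show ?thesis using D'D QP D' by simp
  qed
  let ?X = "\<lambda>B. upper_left k (Q * B * P)" and ?Z = "\<lambda>B. lower_right k m (Q * B * P)"
  define N where "N = (\<lambda>B. A' * B * A)"
  \<comment> \<open>Only the diagonal blocks and the zero corner matter later, so the upper right
    block is left existential.\<close>
  have N: "\<exists>Y \<in> carrier_mat k m. N B = four_block_mat (A1' * ?X B * A1) Y (0\<^sub>m m k) (A2' * ?Z B * A2)"
    if "B \<in> \<B>" for B
  proof -
    have B: "B \<in> carrier_mat ?n ?n" using that \<B> by auto
    have tB: "two_block_triangular k m (Q * B * P)" using that by (rule tri)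
    define X where "X = ?X B"
    define Z where "Z = ?Z B"
    have XZ: "X \<in> carrier_mat k k" "Z \<in> carrier_mat m m" by (simp_all add: X_def Z_def)
    obtain Y where Y: "Y \<in> carrier_mat k m" and M: "Q * B * P = four_block_mat (X) Y (0\<^sub>m m k) (Z)"
      unfolding X_def Z_def by (rule two_block_triangularE[OF tB])
    have c: "A1' * X \<in> carrier_mat k k" "A2' * Z \<in> carrier_mat m m" "A1' * Y \<in> carrier_mat k m"
      using f1(2) f2(2) Y XZ by (auto intro: mult_carrier_mat[of _ k k] mult_carrier_mat[of _ m m])
    have "N B = D' * (Q * B * P) * D"
      unfolding N_def A_def A'_def using P Q D D' B by (simp add: assoc closed)
    also have "D' * (Q * B * P) = four_block_mat (A1' * X) (A1' * Y) (0\<^sub>m m k) (A2' * Z)"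
      unfolding M D'_def
      by (subst mult_four_block_mat[of _ k k _ m _ m _ _ k _ m]) (use f1(2) f2(2) Y c XZ in auto)
    also have "\<dots> * D = four_block_mat (A1' * X * A1) (A1' * Y * A2) (0\<^sub>m m k) (A2' * Z * A2)"
    proof -
      have "A1' * X * A1 \<in> carrier_mat k k" "A1' * Y * A2 \<in> carrier_mat k m" "A2' * Z * A2 \<in> carrier_mat m m"
        using c f1(1) f2(1) by auto
      then show ?thesis
        unfolding D_def
        by (subst mult_four_block_mat[of _ k k _ m _ m _ _ k _ m])
          (use f1(1) f2(1) c in \<open>auto simp: right_mult_zero_mat[OF c(1)] right_mult_zero_mat[OF c(2)] right_mult_zero_mat[OF c(3)]\<close>)
    qed
    finally show ?thesis using c f2(1) unfolding X_def Z_def by auto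
  qed
  have entry1: "N B $$ (r, c) = (A1' * ?X B * A1) $$ (r, c)" if "B \<in> \<B>" "r < k" "c < k" for B r c
    using N[OF that(1)] f1(1,2) that(2,3) by auto
  have entry2: "N B $$ (k + r, k + c) = (A2' * ?Z B * A2) $$ (r, c)" if "B \<in> \<B>" "r < m" "c < m" for B r c
    using N[OF that(1)] f1(1,2) f2(1,2) that(2,3) by auto
  have entry0: "N B $$ (k + r, c) = 0" if "B \<in> \<B>" "r < m" "c < k" for B r c
    using N[OF that(1)] f1(1,2) f2(1,2) that(2,3) by auto
  have start1: "block_start ds1 i + ds1 ! i \<le> k" if "i < length ds1" for i
    using block_start_le[of ds1 "Suc i"] block_start_Suc[OF that] f1(6) by simp
  have start2: "block_start ds2 i + ds2 ! i \<le> m" if "i < length ds2" for i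
    using block_start_le[of ds2 "Suc i"] block_start_Suc[OF that] f2(6) by simp
  have start_app: "block_start (ds1 @ ds2) (length ds1 + i) = k + block_start ds2 i" for i
    using f1(6) by (simp add: block_start_append2)
  have span1: "diagonal_block_span (ds1 @ ds2) i (N ` \<B>) =
      diagonal_block_span ds1 i ((\<lambda>B. A1' * B * A1) ` ?X ` \<B>)" if i: "i < length ds1" for i
  proof (rule diagonal_block_span_eq)
    have "diagonal_block (ds1 @ ds2) i (N B) = diagonal_block ds1 i (A1' * ?X B * A1)" if "B \<in> \<B>" for B
      using i start1[OF i] entry1[OF that]
      by (intro eq_matI) (auto simp: diagonal_block_def nth_append block_start_append1)
    then show "diagonal_block (ds1 @ ds2) i ` N ` \<B> = diagonal_block ds1 i ` (\<lambda>B. A1' * B * A1) ` ?X ` \<B>"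
      by (simp add: image_image)
  qed (use i in \<open>simp add: nth_append\<close>)
  have span2: "diagonal_block_span (ds1 @ ds2) (length ds1 + i) (N ` \<B>) =
      diagonal_block_span ds2 i ((\<lambda>B. A2' * B * A2) ` ?Z ` \<B>)" if i: "i < length ds2" for i
  proof (rule diagonal_block_span_eq)
    have "diagonal_block (ds1 @ ds2) (length ds1 + i) (N B) = diagonal_block ds2 i (A2' * ?Z B * A2)" if "B \<in> \<B>" for B
      using i start2[OF i] entry2[OF that]
      by (intro eq_matI) (auto simp: diagonal_block_def start_app add.assoc)
    then show "diagonal_block (ds1 @ ds2) (length ds1 + i) ` N ` \<B> = diagonal_block ds2 i ` (\<lambda>B. A2' * B * A2) ` ?Z ` \<B>"
      by (simp add: image_image)
  qed (use i in simp)
  have "block_upper_triangular (ds1 @ ds2) (N B)" if B: "B \<in> \<B>" for B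
    unfolding block_upper_triangular_def
  \<comment> \<open>An entry to the left of its diagonal block lies within the first part, in the
    zero corner, or within the second part; these are settled by \<open>form1\<close>,
    \<open>entry0\<close> and \<open>form2\<close>.\<close>
  proof (intro allI impI ballI)
    fix i r c
    assume i: "i < length (ds1 @ ds2)" and c: "c < block_start (ds1 @ ds2) i"
      and r: "r \<in> {block_start (ds1 @ ds2) i..<block_start (ds1 @ ds2) (Suc i)}"
    show "N B $$ (r, c) = 0"
    proof (cases "i < length ds1")
      case True
      then have r': "r \<in> {block_start ds1 i..<block_start ds1 (Suc i)}" and c': "c < block_start ds1 i"
        using r c by (auto simp: block_start_append1)
      then have "(A1' * ?X B * A1) $$ (r, c) = 0"
        using f1(7)[of "?X B"] B True unfolding block_upper_triangular_def by blast
      then show ?thesis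
        using entry1[OF B] r' c' start1[OF True] block_start_Suc[OF True] by simp
    next
      case False
      then obtain j where j: "i = length ds1 + j" using le_Suc_ex not_less by blast
      then have jl: "j < length ds2" using i by simp
      have r': "r \<in> {k + block_start ds2 j..<k + block_start ds2 (Suc j)}"
        using r start_app[of "Suc j"] by (simp add: j start_app)
      then obtain r0 where r0: "r = k + r0" "r0 \<in> {block_start ds2 j..<block_start ds2 (Suc j)}"
        by (metis add_le_cancel_left add_less_cancel_left atLeastLessThan_iff le_Suc_ex add_leD1)
      then have r0m: "r0 < m" using start2[OF jl] block_start_Suc[OF jl] by simp
      show ?thesis
      proof (cases "c < k")
        case True
        then show ?thesis using entry0[OF B r0m] r0 by simp
      next
        case False
        then obtain c0 where c0: "c = k + c0" using le_Suc_ex not_less by blast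
        then have c0l: "c0 < block_start ds2 j" using c by (simp add: j start_app)
        then have "(A2' * ?Z B * A2) $$ (r0, c0) = 0"
          using f2(7)[of "?Z B"] B r0 jl unfolding block_upper_triangular_def by blast
        then show ?thesis using entry2[OF B r0m, of c0] r0 c0 c0l start2[OF jl] by simp
      qed
    qed
  qed
  moreover have "irreducible_matrix_lie_algebra ((ds1 @ ds2) ! i) (diagonal_block_span (ds1 @ ds2) i (N ` \<B>))"
    if i: "i < length (ds1 @ ds2)" for i
  proof (cases "i < length ds1")
    case True
    then show ?thesis using f1(8)[OF True] span1[OF True] by (simp add: nth_append)
  next
    case False
    then obtain j where j: "i = length ds1 + j" using le_Suc_ex not_less by blast
    then have "j < length ds2" using i by simp
    then show ?thesis using f2(8) span2 j by simp
  qed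
  ultimately have "composition_form ?n \<B> A A' (ds1 @ ds2)"
    unfolding composition_form_def N_def[symmetric]
    using A AA' A'A f1(5,6) f2(5,6) by (auto simp: inverts_mat_def N_def)
  then show thesis using span1 span2 unfolding N_def by (intro that) blast+
qed

text \<open>A factor on the invariant subspace survives in the whole algebra once its form is
  completed by some composition form on the quotient.\<close>

lemma composition_factor_upper_left:
  fixes \<B> :: "'a :: field mat set"
  assumes P: "P \<in> carrier_mat (k + m) (k + m)" and Q: "Q \<in> carrier_mat (k + m) (k + m)"
    and PQ: "P * Q = 1\<^sub>m (k + m)" and QP: "Q * P = 1\<^sub>m (k + m)"
    and \<B>: "\<B> \<subseteq> carrier_mat (k + m) (k + m)"
    and tri: "\<And>B. B \<in> \<B> \<Longrightarrow> two_block_triangular k m (Q * B * P)"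
    and factor: "composition_factor k ((\<lambda>B. upper_left k (Q * B * P)) ` \<B>) d \<C>"
    and form2: "composition_form m ((\<lambda>B. lower_right k m (Q * B * P)) ` \<B>) A2 A2' ds2"
  shows "composition_factor (k + m) \<B> d \<C>"
proof -
  obtain A1 A1' ds1 i where form1: "composition_form k ((\<lambda>B. upper_left k (Q * B * P)) ` \<B>) A1 A1' ds1"
    and i: "i < length ds1" "d = ds1 ! i"
    and \<C>: "\<C> = diagonal_block_span ds1 i ((\<lambda>B. A1' * B * A1) ` (\<lambda>B. upper_left k (Q * B * P)) ` \<B>)"
    using factor unfolding composition_factor_def by blast
  obtain A A' where "composition_form (k + m) \<B> A A' (ds1 @ ds2)"
    and "\<forall>i<length ds1. diagonal_block_span (ds1 @ ds2) i ((\<lambda>B. A' * B * A) ` \<B>) =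
      diagonal_block_span ds1 i ((\<lambda>B. A1' * B * A1) ` (\<lambda>B. upper_left k (Q * B * P)) ` \<B>)"
    by (rule composition_form_append[OF P Q PQ QP \<B> tri form1 form2])
  then show ?thesis
    unfolding composition_factor_def \<C> using i
    by (intro exI[of _ A] exI[of _ A'] exI[of _ "ds1 @ ds2"] exI[of _ i]) (simp add: nth_append)
qed

text \<open>The counterpart for the quotient: the factor keeps its place after a shift by the number
  of blocks in front.\<close>

lemma composition_factor_lower_right:
  fixes \<B> :: "'a :: field mat set"
  assumes P: "P \<in> carrier_mat (k + m) (k + m)" and Q: "Q \<in> carrier_mat (k + m) (k + m)"
    and PQ: "P * Q = 1\<^sub>m (k + m)" and QP: "Q * P = 1\<^sub>m (k + m)"
    and \<B>: "\<B> \<subseteq> carrier_mat (k + m) (k + m)"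
    and tri: "\<And>B. B \<in> \<B> \<Longrightarrow> two_block_triangular k m (Q * B * P)"
    and form1: "composition_form k ((\<lambda>B. upper_left k (Q * B * P)) ` \<B>) A1 A1' ds1"
    and factor: "composition_factor m ((\<lambda>B. lower_right k m (Q * B * P)) ` \<B>) d \<C>"
  shows "composition_factor (k + m) \<B> d \<C>"
proof -
  obtain A2 A2' ds2 i where form2: "composition_form m ((\<lambda>B. lower_right k m (Q * B * P)) ` \<B>) A2 A2' ds2"
    and i: "i < length ds2" "d = ds2 ! i"
    and \<C>: "\<C> = diagonal_block_span ds2 i ((\<lambda>B. A2' * B * A2) ` (\<lambda>B. lower_right k m (Q * B * P)) ` \<B>)"
    using factor unfolding composition_factor_def by blast
  obtain A A' where "composition_form (k + m) \<B> A A' (ds1 @ ds2)"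
    and "\<forall>i<length ds2. diagonal_block_span (ds1 @ ds2) (length ds1 + i) ((\<lambda>B. A' * B * A) ` \<B>) =
      diagonal_block_span ds2 i ((\<lambda>B. A2' * B * A2) ` (\<lambda>B. lower_right k m (Q * B * P)) ` \<B>)"
    by (rule composition_form_append[OF P Q PQ QP \<B> tri form1 form2])
  then show ?thesis
    unfolding composition_factor_def \<C> using i
    by (intro exI[of _ A] exI[of _ A'] exI[of _ "ds1 @ ds2"] exI[of _ "length ds1 + i"]) simp
qed

section \<open>Invariant subspaces and existence of composition forms\<close>

lemma conjugate_entry:
  fixes B :: "'a :: field mat"
  assumes P: "P \<in> carrier_mat n n" and Q: "Q \<in> carrier_mat n n" and B: "B \<in> carrier_mat n n"
    and ij: "i < n" "j < n"
  shows "(Q * B * P) $$ (i, j) = (Q *\<^sub>v (B *\<^sub>v (P *\<^sub>v unit_vec n j))) $ i"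
proof -
  have "Q *\<^sub>v (B *\<^sub>v (P *\<^sub>v unit_vec n j)) = Q * B * P *\<^sub>v unit_vec n j"
    using P Q B by (simp add: assoc_mult_mat_vec[of _ n n _ n] mult_carrier_mat[of _ n n _ n])
  then show ?thesis using P Q B ij by (simp add: scalar_prod_right_unit)
qed

text \<open>For \<open>j < k\<close> the \<open>j\<close>-th column of \<open>P\<close> lies in the
  subspace, because its \<open>Q\<close>-coordinates form a unit vector. Its image under
  \<open>B\<close> stays there, so its coordinates from \<open>k\<close> on vanish.\<close>

lemma two_block_triangular_invariant:
  fixes B :: "'a :: field mat"
  assumes P: "P \<in> carrier_mat (k + m) (k + m)" and Q: "Q \<in> carrier_mat (k + m) (k + m)"
    and QP: "Q * P = 1\<^sub>m (k + m)" and B: "B \<in> carrier_mat (k + m) (k + m)"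
    and inv: "\<And>u. u \<in> coord_subspace (k + m) k Q \<Longrightarrow> B *\<^sub>v u \<in> coord_subspace (k + m) k Q"
  shows "two_block_triangular k m (Q * B * P)"
  unfolding two_block_triangular_def
proof (intro conjI allI impI)
  fix i j assume ij: "i < m" "j < k"
  let ?e = "unit_vec (k + m) j :: 'a vec"
  have "Q *\<^sub>v (P *\<^sub>v ?e) = ?e" using assoc_mult_mat_vec[OF Q P] QP by simp
  then have "P *\<^sub>v ?e \<in> coord_subspace (k + m) k Q" using P ij by (simp add: coord_subspace_def)
  then have "B *\<^sub>v (P *\<^sub>v ?e) \<in> coord_subspace (k + m) k Q" by (rule inv)
  then have "(Q *\<^sub>v (B *\<^sub>v (P *\<^sub>v ?e))) $ (k + i) = 0" using ij unfolding coord_subspace_def by simp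
  then show "(Q * B * P) $$ (k + i, j) = 0" using conjugate_entry[OF P Q B] ij by simp
qed (use P Q B in auto)

text \<open>Strong induction on \<open>n\<close>: a nonzero proper invariant subspace splits the
  algebra into two Lie algebras of smaller size, whose forms are appended. For \<open>n = 0\<close>
  the list of blocks is empty, as blocks must have positive size.\<close>

lemma composition_form_exists:
  fixes \<B> :: "'a :: field mat set"
  assumes "matrix_lie_algebra n \<B>"
  shows "\<exists>A A' ds. composition_form n \<B> A A' ds"
  using assms
proof (induction n arbitrary: \<B> rule: less_induct)
  case (less n)
  note lie = less.prems
  note \<B> = matrix_lie_algebraD[OF lie]
  consider "n = 0" | "n > 0" "irreducible_matrix_lie_algebra n \<B>"
    | U where "invariant_subspace n \<B> U" "U \<noteq> {0\<^sub>v n}" "U \<noteq> carrier_vec n"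
    using lie unfolding irreducible_matrix_lie_algebra_def by blast
  then show ?case
  proof cases
    case 1
    then have "composition_form n \<B> (1\<^sub>m 0) (1\<^sub>m 0) []"
      by (simp add: composition_form_def inverts_mat_def block_upper_triangular_def)
    then show ?thesis by blast
  next
    case 2
    then show ?thesis using composition_form_irreducible(1) by blast
  next
    case (3 U)
    have U: "vec_subspace n U" and inv: "\<And>B u. B \<in> \<B> \<Longrightarrow> u \<in> U \<Longrightarrow> B *\<^sub>v u \<in> U"
      using 3(1) by (auto simp: invariant_subspace_def)
    obtain P Q k where P: "P \<in> carrier_mat n n" and Q: "Q \<in> carrier_mat n n"
      and PQ: "P * Q = 1\<^sub>m n" and QP: "Q * P = 1\<^sub>m n" and k: "k \<le> n" and Ueq: "U = coord_subspace n k Q"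
      by (rule adapted_base_change[OF U])
    obtain m where n: "n = k + m" using k le_Suc_ex by blast
    have dim: "subspace_dim n U = k" unfolding Ueq by (rule coord_subspace_dim[OF P Q PQ QP k])
    have "k \<noteq> 0" using subspace_dim_eq_0[OF U] dim 3(2) by auto
    moreover have "k \<noteq> n"
      using subspace_dim_mono(2)[OF U vec_subspace_carrier vec_subspaceD(1)[OF U]] subspace_dim_carrier dim 3(3)
      by metis
    ultimately have less': "k < n" "m < n" using n by auto
    have tri: "two_block_triangular k m (Q * B * P)" if "B \<in> \<B>" for B
      using P Q QP \<B>(1) inv[OF that] that unfolding n Ueq by (intro two_block_triangular_invariant) auto
    let ?M = "(\<lambda>B. Q * B * P) ` \<B>"
    have lieM: "matrix_lie_algebra (k + m) ?M" using matrix_lie_algebra_conjugate[OF lie P Q PQ] n by simp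
    have "matrix_lie_algebra k (upper_left k ` ?M)" "matrix_lie_algebra m (lower_right k m ` ?M)"
      by (rule matrix_lie_algebra_diagonal_blocks[OF lieM]; use tri in blast)+
    then obtain A1 A1' ds1 A2 A2' ds2
      where "composition_form k ((\<lambda>B. upper_left k (Q * B * P)) ` \<B>) A1 A1' ds1"
        "composition_form m ((\<lambda>B. lower_right k m (Q * B * P)) ` \<B>) A2 A2' ds2"
      using less.IH less' unfolding image_image by metis
    from composition_form_append[OF P[unfolded n] Q[unfolded n] PQ[unfolded n] QP[unfolded n] \<B>(1)[unfolded n] tri this]
    show ?thesis using n by metis
  qed
qed

lemma trivial_irreducible_is_irreducible:
  "irreducible_matrix_lie_algebra 1 {0\<^sub>m 1 1 :: 'a :: field mat}"
  unfolding irreducible_matrix_lie_algebra_def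
proof (intro conjI allI impI)
  show "matrix_lie_algebra 1 {0\<^sub>m 1 1 :: 'a mat}" by (rule matrix_lie_algebraI) auto
  fix U :: "'a vec set" assume "invariant_subspace 1 {0\<^sub>m 1 1} U"
  then have U: "vec_subspace 1 U" by (simp add: invariant_subspace_def)
  consider "subspace_dim 1 U = 0" | "subspace_dim 1 U = 1" using subspace_dim_le[OF U] by linarith
  then show "U = {0\<^sub>v 1} \<or> U = carrier_vec 1"
  proof cases
    case 1
    then show ?thesis using subspace_dim_eq_0[OF U] by blast
  next
    case 2
    then show ?thesis
      using subspace_dim_mono(2)[OF U vec_subspace_carrier vec_subspaceD(1)[OF U]] subspace_dim_carrier by metis
  qed
qed

section \<open>Trivial composition factors and shrunk subspaces\<close>

definition has_trivial_factor :: "nat \<Rightarrow> 'a :: field mat set \<Rightarrow> bool" where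
  "has_trivial_factor n \<B> \<longleftrightarrow> (\<exists>d \<C>. composition_factor n \<B> d \<C> \<and> trivial_irreducible d \<C>)"

text \<open>In adapted coordinates \<open>W\<close> lies in the hyperplane where the last coordinate
  vanishes, so \<open>\<B>\<close> acts as zero on a one-dimensional quotient. Any composition form
  of the action on the hyperplane completes this quotient to a form of \<open>\<B>\<close>.\<close>

lemma proper_image_imp_trivial_factor:
  fixes \<B> :: "'a :: field mat set"
  assumes lie: "matrix_lie_algebra n \<B>" and W: "vec_subspace n W" and proper: "W \<noteq> carrier_vec n"
    and BW: "\<And>B v. B \<in> \<B> \<Longrightarrow> v \<in> carrier_vec n \<Longrightarrow> B *\<^sub>v v \<in> W"
  shows "has_trivial_factor n \<B>"
proof -
  note \<B> = matrix_lie_algebraD[OF lie]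
  obtain P Q k where P: "P \<in> carrier_mat n n" and Q: "Q \<in> carrier_mat n n"
    and PQ: "P * Q = 1\<^sub>m n" and QP: "Q * P = 1\<^sub>m n" and k: "k \<le> n" and Weq: "W = coord_subspace n k Q"
    by (rule adapted_base_change[OF W])
  have "k \<noteq> n" using proper Weq by (auto simp: coord_subspace_def)
  then have kn: "k < n" using k by simp
  \<comment> \<open>the last row of every \<open>Q B P\<close> vanishes, so the last \<open>1\<times>1\<close> block is a trivial factor\<close>
  obtain l where n: "n = l + 1" using kn by (metis Suc_eq_plus1 less_imp_Suc_add)
  have row0: "(Q * B * P) $$ (l, j) = 0" if "B \<in> \<B>" "j < n" for B j
  proof -
    have "B *\<^sub>v (P *\<^sub>v unit_vec n j) \<in> W" using BW that P by auto
    then show ?thesis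
      using conjugate_entry[OF P Q, of B l j] that \<B>(1) kn n by (auto simp: Weq coord_subspace_def)
  qed
  have tri: "two_block_triangular l 1 (Q * B * P)" if "B \<in> \<B>" for B
    using that row0[OF that] P Q \<B>(1) n by (auto simp: two_block_triangular_def)
  let ?M = "(\<lambda>B. Q * B * P) ` \<B>"
  have lieM: "matrix_lie_algebra (l + 1) ?M" using matrix_lie_algebra_conjugate[OF lie P Q PQ] n by simp
  have "matrix_lie_algebra l (upper_left l ` ?M)"
    by (rule matrix_lie_algebra_diagonal_blocks(1)[OF lieM]) (use tri in blast)
  then obtain A1 A1' ds1 where form1: "composition_form l ((\<lambda>B. upper_left l (Q * B * P)) ` \<B>) A1 A1' ds1"
    using composition_form_exists unfolding image_image by metis
  have "lower_right l 1 (Q * B * P) = 0\<^sub>m 1 1" if "B \<in> \<B>" for B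
    using row0[OF that, of l] n by (intro eq_matI) (auto simp: lower_right_def)
  \<comment> \<open>Since \<open>\<B>\<close> contains the zero matrix, the image is this singleton
    and not empty.\<close>
  then have "(\<lambda>B. lower_right l 1 (Q * B * P)) ` \<B> = {0\<^sub>m 1 1}" using \<B>(2) by force
  moreover have "composition_factor 1 {0\<^sub>m 1 1 :: 'a mat} 1 {0\<^sub>m 1 1}"
    unfolding composition_factor_def
    using composition_form_irreducible[OF trivial_irreducible_is_irreducible, where 'a = 'a]
    by (intro exI[of _ "1\<^sub>m 1"] exI[of _ "[1]"] exI[of _ "0 :: nat"]) simp
  ultimately have factor: "composition_factor 1 ((\<lambda>B. lower_right l 1 (Q * B * P)) ` \<B>) 1 {0\<^sub>m 1 1}" by simp
  from composition_factor_lower_right[OF P[unfolded n] Q[unfolded n] PQ[unfolded n] QP[unfolded n] \<B>(1)[unfolded n] tri form1 factor]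
  show ?thesis unfolding has_trivial_factor_def n by (auto simp: trivial_irreducible_def)
qed

text \<open>On an invariant shrunk \<open>U\<close> the induced algebra has image in the proper
  subspace \<open>\<B>(U)\<close>, so the upper left block has a trivial factor by the previous
  criterion; a composition form of the lower right block carries it over to
  \<open>\<B>\<close>.\<close>

lemma shrunk_imp_trivial_factor:
  fixes \<B> :: "'a :: field mat set"
  assumes lie: "matrix_lie_algebra n \<B>" and shrunk: "has_shrunk_subspace n \<B>"
  shows "has_trivial_factor n \<B>"
proof -
  note \<B> = matrix_lie_algebraD[OF lie]
  obtain U where shU: "shrunk_subspace n \<B> U" and invU: "invariant_subspace n \<B> U"
    by (rule shrunk_imp_invariant_shrunk[OF lie shrunk])
  have U: "vec_subspace n U" and inv: "\<And>B u. B \<in> \<B> \<Longrightarrow> u \<in> U \<Longrightarrow> B *\<^sub>v u \<in> U"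
    using invU by (auto simp: invariant_subspace_def)
  define W where "W = action_span n \<B> U"
  have W: "vec_subspace n W" unfolding W_def by (rule action_span_subspace[OF \<B>(1) vec_subspaceD(1)[OF U]])
  have BW: "B *\<^sub>v u \<in> W" if "B \<in> \<B>" "u \<in> U" for B u
    unfolding W_def using that by (rule action_in_action_span[OF \<B>(1) vec_subspaceD(1)[OF U]])
  have UW: "\<not> U \<subseteq> W"
    using shU subspace_dim_mono(1)[OF U W] by (auto simp: shrunk_subspace_def W_def)
  obtain P Q k where P: "P \<in> carrier_mat n n" and Q: "Q \<in> carrier_mat n n"
    and PQ: "P * Q = 1\<^sub>m n" and QP: "Q * P = 1\<^sub>m n" and k: "k \<le> n" and Ueq: "U = coord_subspace n k Q"
    by (rule adapted_base_change[OF U])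
  obtain m where n: "n = k + m" using k le_Suc_ex by blast
  have tri: "two_block_triangular k m (Q * B * P)" if "B \<in> \<B>" for B
    using P Q QP \<B>(1) inv[OF that] that unfolding n Ueq by (intro two_block_triangular_invariant) auto
  let ?M = "(\<lambda>B. Q * B * P) ` \<B>"
  have lieM: "matrix_lie_algebra (k + m) ?M" using matrix_lie_algebra_conjugate[OF lie P Q PQ] n by simp
  have lie1: "matrix_lie_algebra k ((\<lambda>B. upper_left k (Q * B * P)) ` \<B>)"
    and lie2: "matrix_lie_algebra m ((\<lambda>B. lower_right k m (Q * B * P)) ` \<B>)"
    using matrix_lie_algebra_diagonal_blocks[OF lieM] tri unfolding image_image by blast+
  \<comment> \<open>\<open>e\<close> identifies the coordinate \<open>k\<close>-space with
    \<open>U\<close>; its inverse takes the first \<open>k\<close> entries of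
    \<open>Q *\<^sub>v u\<close>.\<close>
  define e where "e = (\<lambda>v :: 'a vec. P *\<^sub>v (v @\<^sub>v 0\<^sub>v m))"
  have e_U: "e v \<in> U" and Qe: "Q *\<^sub>v e v = v @\<^sub>v 0\<^sub>v m" if v: "v \<in> carrier_vec k" for v
  proof -
    have v0: "v @\<^sub>v 0\<^sub>v m \<in> carrier_vec n" using v n by simp
    show Qe: "Q *\<^sub>v e v = v @\<^sub>v 0\<^sub>v m"
      unfolding e_def using assoc_mult_mat_vec[OF Q P v0] QP v0 by simp
    have "e v \<in> carrier_vec n" unfolding e_def using P v0 by auto
    then show "e v \<in> U" using Qe v n by (auto simp: Ueq coord_subspace_def)
  qed
  \<comment> \<open>\<open>W'\<close> is \<open>\<B>(U)\<close> in the coordinates of \<open>U\<close>, a proper subspace containing the image of the first block\<close>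
  define W' where "W' = {v \<in> carrier_vec k. e v \<in> W}"
  have e_add: "e (u + v) = e u + e v" if "u \<in> carrier_vec k" "v \<in> carrier_vec k" for u v
  proof -
    have "(u + v) @\<^sub>v 0\<^sub>v m = (u @\<^sub>v 0\<^sub>v m) + (v @\<^sub>v 0\<^sub>v m)"
      using that by (intro eq_vecI) auto
    then show ?thesis unfolding e_def using that P n by (simp add: mult_add_distrib_mat_vec[of _ n n])
  qed
  have e_smult: "e (c \<cdot>\<^sub>v v) = c \<cdot>\<^sub>v e v" if "v \<in> carrier_vec k" for c v
  proof -
    have "(c \<cdot>\<^sub>v v) @\<^sub>v 0\<^sub>v m = c \<cdot>\<^sub>v (v @\<^sub>v 0\<^sub>v m)"
      using that by (intro eq_vecI) auto
    then show ?thesis unfolding e_def using that P n by (simp add: mult_mat_vec[of _ n n])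
  qed
  have e_0: "e (0\<^sub>v k) = 0\<^sub>v n"
  proof -
    have "0\<^sub>v k @\<^sub>v 0\<^sub>v m = (0\<^sub>v n :: 'a vec)" using n by (intro eq_vecI) auto
    then show ?thesis unfolding e_def using P by auto
  qed
  have "vec_subspace k W'"
    by (rule vec_subspaceI) (use vec_subspaceD[OF W] in \<open>auto simp: W'_def e_add e_smult e_0\<close>)
  moreover have "W' \<noteq> carrier_vec k"
  proof
    assume eq: "W' = carrier_vec k"
    have "u \<in> W" if u: "u \<in> U" for u
    proof -
      have uc: "u \<in> carrier_vec n" using u vec_subspaceD(1)[OF U] by auto
      define v where "v = vec k (($) (Q *\<^sub>v u))"
      have "Q *\<^sub>v u = v @\<^sub>v 0\<^sub>v m"
        using u Q n unfolding Ueq coord_subspace_def v_def by (intro eq_vecI) auto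
      then have "u = e v"
        unfolding e_def using assoc_mult_mat_vec[OF P Q uc] PQ uc by simp
      moreover have "v \<in> W'" unfolding eq by (simp add: v_def)
      ultimately show ?thesis by (simp add: W'_def)
    qed
    then show False using UW by blast
  qed
  \<comment> \<open>The map \<open>e\<close> intertwines the first block with \<open>B\<close>:
    \<open>e (X *\<^sub>v v) = B *\<^sub>v e v\<close>.\<close>
  moreover have "X *\<^sub>v v \<in> W'" if X: "X \<in> (\<lambda>B. upper_left k (Q * B * P)) ` \<B>" and v: "v \<in> carrier_vec k" for X v
  proof -
    obtain B where B: "B \<in> \<B>" and Xeq: "X = upper_left k (Q * B * P)" using X by blast
    have Bc: "B \<in> carrier_mat n n" using B \<B>(1) by auto
    have Xc: "X \<in> carrier_mat k k" by (simp add: Xeq)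
    obtain Y where Y: "Y \<in> carrier_mat k m"
      and M: "Q * B * P = four_block_mat X Y (0\<^sub>m m k) (lower_right k m (Q * B * P))"
      unfolding Xeq by (rule two_block_triangularE[OF tri[OF B]])
    have v0: "v @\<^sub>v 0\<^sub>v m \<in> carrier_vec n" using v n by simp
    have "Q * B * P *\<^sub>v (v @\<^sub>v 0\<^sub>v m) = (X *\<^sub>v v + Y *\<^sub>v 0\<^sub>v m) @\<^sub>v (0\<^sub>m m k *\<^sub>v v + lower_right k m (Q * B * P) *\<^sub>v 0\<^sub>v m)"
      by (subst M, rule four_block_mat_mult_vec[OF Xc Y _ _ v]) auto
    also have "Y *\<^sub>v 0\<^sub>v m = 0\<^sub>v k" using Y by auto
    also have "lower_right k m (Q * B * P) *\<^sub>v 0\<^sub>v m = 0\<^sub>v m"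
      by (intro eq_vecI) (auto simp: lower_right_def)
    also have "0\<^sub>m m k *\<^sub>v v = 0\<^sub>v m" using v by (intro eq_vecI) auto
    finally have eq: "Q * B * P *\<^sub>v (v @\<^sub>v 0\<^sub>v m) = X *\<^sub>v v @\<^sub>v 0\<^sub>v m" using Xc v by auto
    have "e (X *\<^sub>v v) = P *\<^sub>v (Q * B * P *\<^sub>v (v @\<^sub>v 0\<^sub>v m))" unfolding e_def eq ..
    also have "\<dots> = P * Q *\<^sub>v (B *\<^sub>v e v)"
      unfolding e_def using P Q Bc v0
      by (simp add: assoc_mult_mat_vec[of _ n n _ n] mult_carrier_mat[of _ n n _ n])
    also have "\<dots> = B *\<^sub>v e v" using PQ Bc e_U[OF v] vec_subspaceD(1)[OF U] by auto
    also have "\<dots> \<in> W" using B e_U[OF v] by (rule BW)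
    finally show ?thesis using Xc v by (auto simp: W'_def)
  qed
  ultimately have "has_trivial_factor k ((\<lambda>B. upper_left k (Q * B * P)) ` \<B>)"
    using proper_image_imp_trivial_factor[OF lie1] by blast
  then obtain d \<C> where factor: "composition_factor k ((\<lambda>B. upper_left k (Q * B * P)) ` \<B>) d \<C>"
    and triv: "trivial_irreducible d \<C>"
    by (auto simp: has_trivial_factor_def)
  obtain A2 A2' ds2 where form2: "composition_form m ((\<lambda>B. lower_right k m (Q * B * P)) ` \<B>) A2 A2' ds2"
    using composition_form_exists[OF lie2] by blast
  from composition_factor_upper_left[OF P[unfolded n] Q[unfolded n] PQ[unfolded n] QP[unfolded n] \<B>(1)[unfolded n] tri factor form2]
  show ?thesis unfolding has_trivial_factor_def n using triv by blast
qed

lemma trivial_factor_imp_shrunk: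
  fixes \<B> :: "'a :: field mat set"
  assumes lie: "matrix_lie_algebra n \<B>" and factor: "has_trivial_factor n \<B>"
  shows "has_shrunk_subspace n \<B>"
proof -
  note \<B> = matrix_lie_algebraD[OF lie]
  obtain A A' ds i where form: "composition_form n \<B> A A' ds" and i: "i < length ds" and di: "ds ! i = 1"
    and span: "diagonal_block_span ds i ((\<lambda>B. A' * B * A) ` \<B>) = {0\<^sub>m 1 1}"
    using factor unfolding has_trivial_factor_def composition_factor_def trivial_irreducible_def by metis
  note f = composition_formD[OF form]
  define s where "s = block_start ds i"
  have s1: "block_start ds (Suc i) = s + 1" using block_start_Suc[OF i] di by (simp add: s_def)
  then have sn: "s + 1 \<le> n" using block_start_le[of ds "Suc i"] f(6) by simp
  \<comment> \<open>As \<open>A'\<close> inverts \<open>A\<close>, these are the spans of the first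
    \<open>s + 1\<close> and the first \<open>s\<close> columns of \<open>A\<close>; the trivial
    block occupies exactly the index \<open>s\<close>.\<close>
  let ?U = "coord_subspace n (s + 1) A'" and ?W = "coord_subspace n s A'"
  have U: "vec_subspace n ?U" and W: "vec_subspace n ?W"
    by (intro coord_subspace_is_subspace f(2))+
  \<comment> \<open>Triangularity gives these zeros except at position \<open>(s, s)\<close>, which
    is the entry of the trivial block.\<close>
  have zero: "(A' * B * A) $$ (r, c) = 0" if B: "B \<in> \<B>" and r: "s \<le> r" "r < n" and c: "c \<le> s" for B r c
  proof -
    obtain i' where i': "i' < length ds" "block_start ds i' \<le> r" "r < block_start ds (Suc i')"
      using block_index_exists[of r ds] f(6) r(2) by auto
    have upper: "(A' * B * A) $$ (r, c) = 0" if "c < block_start ds i'"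
      using f(7)[OF B] i' that unfolding block_upper_triangular_def by auto
    have "i \<le> i'"
    proof (rule ccontr)
      assume "\<not> i \<le> i'"
      then have "block_start ds (Suc i') \<le> s" unfolding s_def by (intro block_start_mono) simp
      then show False using i'(3) r(1) by simp
    qed
    then consider "i' = i" "c < s" | "i' = i" "c = s" | "Suc i \<le> i'" using c by linarith
    then show ?thesis
    proof cases
      case 1
      then show ?thesis using upper by (simp add: s_def)
    next
      case 2
      then have "r = s" using i'(3) r(1) s1 by simp
      \<comment> \<open>The block belongs to its own span, which is zero.\<close>
      have "diagonal_block ds i (A' * B * A) = 0\<^sub>m 1 1"
        using diagonal_block_in_span[of "A' * B * A" "(\<lambda>B. A' * B * A) ` \<B>" ds i] B span by auto
      then have "diagonal_block ds i (A' * B * A) $$ (0, 0) = 0" by simp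
      then show ?thesis using 2 \<open>r = s\<close> di by (simp add: diagonal_block_def s_def)
    next
      case 3
      then have "s + 1 \<le> block_start ds i'" using block_start_mono[OF 3, of ds] s1 by simp
      then show ?thesis using upper c by simp
    qed
  qed
  have BU: "B *\<^sub>v u \<in> ?W" if B: "B \<in> \<B>" and u: "u \<in> ?U" for B u
  proof -
    have Bc: "B \<in> carrier_mat n n" using B \<B>(1) by auto
    have uc: "u \<in> carrier_vec n" and u0: "\<And>c. s + 1 \<le> c \<Longrightarrow> c < n \<Longrightarrow> (A' *\<^sub>v u) $ c = 0"
      using u by (auto simp: coord_subspace_def)
    define N where "N = A' * B * A"
    define w where "w = A' *\<^sub>v u"
    have N: "N \<in> carrier_mat n n" and w: "w \<in> carrier_vec n"
      unfolding N_def w_def using f(1,2) Bc uc by auto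
    have "A *\<^sub>v w = u" unfolding w_def using assoc_mult_mat_vec[OF f(1,2) uc] f(3) uc by simp
    then have "A' *\<^sub>v (B *\<^sub>v u) = N *\<^sub>v w"
      unfolding N_def using f(1,2) Bc w
      by (simp add: assoc_mult_mat_vec[of _ n n _ n] mult_carrier_mat[of _ n n _ n])
    moreover have "(N *\<^sub>v w) $ r = 0" if r: "s \<le> r" "r < n" for r
    proof -
      have "(N *\<^sub>v w) $ r = (\<Sum>c<n. N $$ (r, c) * w $ c)"
        using N w r by (simp add: scalar_prod_def atLeast0LessThan)
      also have "\<dots> = 0"
      \<comment> \<open>Columns up to \<open>s\<close> contribute nothing by \<open>zero\<close>,
        and later ones because \<open>u\<close> lies in \<open>?U\<close>.\<close>
      proof (rule sum.neutral, rule ballI)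
        fix c assume c: "c \<in> {..<n}"
        show "N $$ (r, c) * w $ c = 0"
          using zero[OF B r, of c] u0[of c] c by (cases "c \<le> s") (auto simp: N_def w_def)
      qed
      finally show ?thesis .
    qed
    ultimately show ?thesis using Bc uc by (auto simp: coord_subspace_def)
  qed
  have "action_span n \<B> ?U \<subseteq> ?W"
    by (rule action_span_minimal[OF \<B>(1) vec_subspaceD(1)[OF U] W BU])
  then have "subspace_dim n (action_span n \<B> ?U) \<le> subspace_dim n ?W"
    by (intro subspace_dim_mono(1) action_span_subspace \<B>(1) vec_subspaceD(1)[OF U] W)
  moreover have "subspace_dim n ?W = s" "subspace_dim n ?U = s + 1"
    by (intro coord_subspace_dim[OF f(1-4)]; use sn in simp)+
  ultimately show ?thesis
    using U unfolding has_shrunk_subspace_def shrunk_subspace_def by (intro exI[of _ ?U]) simp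
qed

theorem theorem1p1:
  fixes n :: nat and \<B> :: "complex mat set"
  shows "(irreducible_matrix_lie_algebra n \<B> \<and> \<not> trivial_irreducible n \<B>
            \<longrightarrow> \<not> has_shrunk_subspace n \<B>) \<and>
         (matrix_lie_algebra n \<B>
            \<longrightarrow> (has_shrunk_subspace n \<B> \<longleftrightarrow>
                 (\<exists>d \<C>. composition_factor n \<B> d \<C> \<and> trivial_irreducible d \<C>)))"
  using irreducible_shrunk_imp_trivial shrunk_imp_trivial_factor trivial_factor_imp_shrunk
  unfolding has_trivial_factor_def by blast

end
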